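(* Let $d,N\in\mathbb{N}$, $s\in(0,1)$ and let $u\in C_c([0,1]^d)$. Then, as $S\to\infty$ (with $S\in\mathbb{N}$), $$S^{-2s}\big((\widetilde{-\Delta})^s_{S,N}u\big)(x_\kappa)\longrightarrow \big((-\Delta)^s_N u\big)(x_\kappa)\qquad\text{for all } x_\kappa=\kappa/N,\ \kappa\in\{0,\dots,N-1\}^d,$$ where $(\widetilde{-\Delta})^s_{S,N}$ is the discretized scaled periodic fractional Laplacian and $(-\Delta)^s_N$ is the sinc-fractional Laplacian, as defined in the context.
   Context: Index sets: for $M\in\mathbb{N}$ let $\mathcal I_M=\{0,\dots,M-1\}$ and, for even $M$, $\mathcal I'_M=\{-M/2,\dots,M/2-1\}$; $\mathcal I_M^d$ and ${\mathcal I'}_M^d$ denote $d$-fold Cartesian products. For $k\in\mathcal I_N^d$ write $u_k=u(k/N)$. $|\cdot|$ is the Euclidean norm and $a\cdot b$ the Euclidean inner product. Fractional Laplacian on $\mathbb{R}^d$: $(-\Delta)^s v=\mathcal F^{-1}\big(|\omega|^{2s}\,\mathcal F v(\omega)\big)$, where $\mathcal F$ is the Fourier transform on $\mathbb{R}^d$ (normalized so that $\mathcal F^{-1}g(x)=\int_{\mathbb{R}^d} g(\omega)e^{\mathrm i\omega\cdot x}\,d\omega$). Sinc-fractional Laplacian: let $\operatorname{sinc}(t)=\frac{\sin(\pi t)}{\pi t}$ (with $\operatorname{sinc}(0)=1$), $\varphi(x)=\prod_{j=1}^d\operatorname{sinc}(x_j)$ and $\varphi_k^N(x)=\varphi(Nx-k)$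 for $k\in\mathbb{Z}^d$, $x\in\mathbb{R}^d$. One has $\mathcal F\varphi_k^N(\omega)=(2\pi N)^{-d}\chi_{D_N}(\omega)e^{-\mathrm i\omega\cdot k/N}$ with $D_N=[-N\pi,N\pi]^d$. Put $u_N=\sum_{k\in\mathcal I_N^d}u_k\varphi_k^N$ and define $(-\Delta)^s_N u:=(-\Delta)^s u_N$. Explicitly, for $\kappa\in\mathcal I_N^d$ and $x_\kappa=\kappa/N$, $$\big((-\Delta)^s_N u\big)(x_\kappa)=\sum_{k\in\mathcal I_N^d}u_k\,\Phi^N(\kappa-k),\qquad \Phi^N(\kappa-k)=\big((-\Delta)^s\varphi_k^N\big)(x_\kappa)=(2\pi N)^{-d}\int_{D_N}|\omega|^{2s}e^{\mathrm i\,\omega\cdot(\kappa-k)/N}\,d\omega .$$ Discretized scaled periodic fractional Laplacian: extend $(u_k)_{k\in\mathcal I_N^d}$ by zero to a vector $(\bar u_k)_{k\in\mathcal I_{SN}^d}$ (i.e. $\bar u_k=u_k$ if all components of $k$ are $<N$, and $\bar u_k=0$ otherwise), let $\hat u_j=\sum_{k\in\mathcal I_{SN}^d}\bar u_k e^{-2\pi\mathrm i\, j\cdot k/(SN)}$, and for $\kappa\in\mathcal I_N^d$ define $$\big((\widetilde{-\Delta})^s_{S,N}u\big)(x_\kappa)=\frac1{(SN)^d}\sum_{j\in{\mathcal I'}_{SN}^d}|2\pi j|^{2s}\,\hat u_j\,e^{2\pi\mathrm i\, j\cdot\kappa/(SN)}=\frac{(2\pi)^{2s}}{(SN)^d}\sum_{k\in\mathcal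 I_N^d}u_k\sum_{j\in{\mathcal I'}_{SN}^d}|j|^{2s}e^{\frac{2\pi\mathrm i}{SN}j\cdot(\kappa-k)} .$$ It is understood that $SN$ is even, so that $\mathcal I'_{SN}$ is defined. *)

theory Defs
  imports "HOL-Probability.Sinc_Integral"
begin

text \<open>The space dimension \<open>d\<close> is \<open>CARD('d)\<close>. Multi-indices in \<open>\<int>\<^sup>d\<close> are integer vectors
  \<open>int ^ 'd\<close>.\<close>

definition real_vec :: "int ^ 'd \<Rightarrow> real ^ 'd" where
  "real_vec k = (\<chi> i. real_of_int (k $ i))"

definition idx :: "nat \<Rightarrow> (int ^ 'd) set" where
  "idx M = {k. \<forall>i. 0 \<le> k $ i \<and> k $ i \<le> int M - 1}"

text \<open>Only meaningful for even \<open>M\<close>.\<close>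

definition idx_sym :: "nat \<Rightarrow> (int ^ 'd) set" where
  "idx_sym M = {j. \<forall>i. - (int M div 2) \<le> j $ i \<and> j $ i \<le> int M div 2 - 1}"

definition grid_point :: "nat \<Rightarrow> int ^ 'd \<Rightarrow> real ^ 'd" where
  "grid_point N k = (1 / real N) *\<^sub>R real_vec k"

text \<open>Continuous functions on \<open>K\<close> whose support, i.e. the closure relative to \<open>K\<close> of the set where
  they do not vanish, is compact. Nothing is required of the values outside \<open>K\<close>.\<close>

definition Cc :: "(real ^ 'd) set \<Rightarrow> (real ^ 'd \<Rightarrow> complex) set" where
  "Cc K = {u. continuous_on K u \<and> compact (K \<inter> closure {x \<in> K. u x \<noteq> 0})}"


section \<open>Fourier transform and fractional Laplacian\<close>

definition square_integrable :: "(real ^ 'd \<Rightarrow> complex) \<Rightarrow> bool" where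
  "square_integrable v \<longleftrightarrow>
     v \<in> borel_measurable lborel \<and> integrable lborel (\<lambda>x. (cmod (v x))\<^sup>2)"

definition truncated_fourier :: "real \<Rightarrow> (real ^ 'd \<Rightarrow> complex) \<Rightarrow> real ^ 'd \<Rightarrow> complex" where
  "truncated_fourier R v \<omega> =
     complex_of_real (1 / (2 * pi) ^ CARD('d)) *
     (LINT x:cbox (\<chi> i. - R) (\<chi> i. R)|lborel. v x * cis (- (\<omega> \<bullet> x)))"

text \<open>The sinc function is not absolutely integrable, so the Fourier transform has to be taken in the
  sense of \<open>L\<^sup>2\<close> (Plancherel): it is the \<open>L\<^sup>2\<close>-limit of the Fourier integrals of the truncations
  to \<open>[-R, R]\<^sup>d\<close>.\<close>

definition is_fourier_transform ::
    "(real ^ 'd \<Rightarrow> complex) \<Rightarrow> (real ^ 'd \<Rightarrow> complex) \<Rightarrow> bool" where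
  "is_fourier_transform v g \<longleftrightarrow>
     square_integrable v \<and> square_integrable g \<and>
     ((\<lambda>R. \<integral>\<^sup>+ \<omega>. ennreal ((cmod (truncated_fourier R v \<omega> - g \<omega>))\<^sup>2) \<partial>lborel) \<longlongrightarrow> 0) at_top"

text \<open>The Fourier transform is determined up to a null set only; the choice of the representative is
  immaterial below, because it only occurs under an integral.\<close>

definition fourier :: "(real ^ 'd \<Rightarrow> complex) \<Rightarrow> real ^ 'd \<Rightarrow> complex" where
  "fourier v = (SOME g. is_fourier_transform v g)"

text \<open>The inverse transform as an absolutely convergent integral, i.e. for integrable \<open>g\<close>. This covers
  \<open>g(\<omega>) = |\<omega>|\<^sup>2\<^sup>s (\<F> v)(\<omega>)\<close> for band-limited \<open>v\<close>, such as the sinc interpolants below.\<close>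

definition inv_fourier :: "(real ^ 'd \<Rightarrow> complex) \<Rightarrow> real ^ 'd \<Rightarrow> complex" where
  "inv_fourier g x = (LINT \<omega>|lborel. g \<omega> * cis (\<omega> \<bullet> x))"

definition frac_laplacian :: "real \<Rightarrow> (real ^ 'd \<Rightarrow> complex) \<Rightarrow> real ^ 'd \<Rightarrow> complex" where
  "frac_laplacian s v = inv_fourier (\<lambda>\<omega>. complex_of_real (norm \<omega> powr (2 * s)) * fourier v \<omega>)"


section \<open>Sinc-fractional Laplacian\<close>

text \<open>The library function \<open>sinc\<close> is the unnormalized \<open>sin t / t\<close>.\<close>

definition sinc_prod :: "real ^ 'd \<Rightarrow> real" where
  "sinc_prod x = (\<Prod>i\<in>UNIV. sinc (pi * x $ i))"

definition sinc_basis :: "nat \<Rightarrow> int ^ 'd \<Rightarrow> real ^ 'd \<Rightarrow> real" where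
  "sinc_basis N k x = sinc_prod (real N *\<^sub>R x - real_vec k)"

definition sinc_interp :: "nat \<Rightarrow> (real ^ 'd \<Rightarrow> complex) \<Rightarrow> real ^ 'd \<Rightarrow> complex" where
  "sinc_interp N u x = (\<Sum>k\<in>idx N. u (grid_point N k) * complex_of_real (sinc_basis N k x))"

definition sinc_frac_laplacian ::
    "real \<Rightarrow> nat \<Rightarrow> (real ^ 'd \<Rightarrow> complex) \<Rightarrow> real ^ 'd \<Rightarrow> complex" where
  "sinc_frac_laplacian s N u = frac_laplacian s (sinc_interp N u)"


section \<open>Discretized scaled periodic fractional Laplacian\<close>

definition zero_ext :: "nat \<Rightarrow> (real ^ 'd \<Rightarrow> complex) \<Rightarrow> int ^ 'd \<Rightarrow> complex" where
  "zero_ext N u k = (if k \<in> idx N then u (grid_point N k) else 0)"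

definition dft :: "nat \<Rightarrow> (int ^ 'd \<Rightarrow> complex) \<Rightarrow> int ^ 'd \<Rightarrow> complex" where
  "dft M w j = (\<Sum>k\<in>idx M. w k * cis (- 2 * pi * (real_vec j \<bullet> real_vec k) / real M))"

text \<open>The value at the grid point \<open>\<kappa>/N\<close>, as a function of the multi-index \<open>\<kappa>\<close>. Only meaningful when
  \<open>S * N\<close> is even.\<close>

definition periodic_frac_laplacian ::
    "real \<Rightarrow> nat \<Rightarrow> nat \<Rightarrow> (real ^ 'd \<Rightarrow> complex) \<Rightarrow> int ^ 'd \<Rightarrow> complex" where
  "periodic_frac_laplacian s S N u \<kappa> =
     complex_of_real (1 / real (S * N) ^ CARD('d)) *
     (\<Sum>j\<in>idx_sym (S * N).
        complex_of_real (norm ((2 * pi) *\<^sub>R real_vec j) powr (2 * s)) *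
        dft (S * N) (zero_ext N u) j *
        cis (2 * pi * (real_vec j \<bullet> real_vec \<kappa>) / real (S * N)))"

end

theory Submission
  imports Defs
begin

text \<open>
  Both operators multiply frequencies by \<open>|\<omega>|\<^sup>2\<^sup>s\<close>, one with continuous and one with discrete
  frequencies. Let \<open>F(\<omega>) = |\<omega>|\<^sup>2\<^sup>s (\<Sum>\<^sub>k u\<^sub>k e\<^sup>-\<^sup>i\<^sup>\<omega>\<^sup>\<cdot>\<^sup>k\<^sup>/\<^sup>N) e\<^sup>i\<^sup>\<omega>\<^sup>\<cdot>\<^sup>\<kappa>\<^sup>/\<^sup>N\<close>. Up to the common factor
  \<open>(2\<pi>N)\<^sup>-\<^sup>d\<close> the sinc-fractional Laplacian is the integral of \<open>F\<close> over the cube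
  \<open>[-\<pi>N, \<pi>N]\<^sup>d\<close>. Substituting \<open>\<omega> = 2\<pi>j/S\<close> turns \<open>S\<^sup>-\<^sup>2\<^sup>s\<close> times the periodic operator into the
  Riemann sum of \<open>F\<close> for the grid of mesh \<open>2\<pi>/S\<close> on the same cube: the points
  \<open>2\<pi>j/S\<close> with \<open>j \<in> {-SN/2, ..., SN/2 - 1}\<^sup>d\<close> are precisely the lower corners of the cells that tile the cube. As
  \<open>s > 0\<close>, the function \<open>F\<close> is continuous also at the origin, so the Riemann sums converge
  (\<open>riemann_sum_eq_integral\<close>, \<open>riemann_integral_tendsto\<close>).

  The substance is the integral formula for the sinc-fractional Laplacian
  (\<open>sinc_frac_laplacian_eq_cube_integral\<close>). Its Fourier transform is an \<open>L\<^sup>2\<close>-limit of truncated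
  Fourier integrals, given by a choice operator, so it has to be shown that this limit exists for the
  sinc interpolant, that it is the expected band-limited function, and that such limits are unique
  almost everywhere (\<open>is_fourier_transform_sinc_interp\<close>, \<open>is_fourier_transform_unique\<close>). Plancherel's
  theorem is avoided. Truncation to a cube makes the truncated transform of a product of sinc
  functions a product of one-dimensional integrals. Each of these converges pointwise off the band
  edge, because it reduces to the sine integral, and is bounded by a multiple of \<open>1/(1 + |\<omega>|)\<close>
  uniformly in the truncation. This weight is square integrable, and so is its product over the
  coordinates. Dominated convergence then gives the \<open>L\<^sup>2\<close>-limit in all coordinates at once.
\<close>

section \<open>Truncated Fourier integrals of the sinc function on the line\<close>

lemma abs_sinc_le_1: "\<bar>sinc x\<bar> \<le> 1"
proof (cases "x = 0")
  case False
  then show ?thesis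
    using abs_sin_x_le_abs_x[of x] by (simp add: field_simps)
qed simp

lemma mult_sinc: "x * sinc x = sin x"
  by auto

lemma sinc_eq_integral_cis:
  "complex_of_real (sinc y) = integral {-1..1} (\<lambda>t. cis (y * t)) / 2"
proof (cases "y = 0")
  case False
  have "((\<lambda>t. cis (y * t)) has_integral
      (cis (y * 1) / (\<i> * y) - cis (y * (-1)) / (\<i> * y))) {-1..1}"
    by (rule fundamental_theorem_of_calculus)
      (use False in \<open>auto simp: has_vector_derivative_def scaleR_conv_of_real
         fun_eq_iff complex_eq_iff intro!: derivative_eq_intros\<close>)
  then have "integral {-1..1} (\<lambda>t. cis (y * t)) = (cis y - cis (-y)) / (\<i> * y)"
    by (simp add: integral_unique diff_divide_distrib)
  also have "\<dots> = 2 * sinc y"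
    using False by (simp add: complex_eq_iff Re_divide Im_divide power2_eq_square)
  finally show ?thesis by simp
qed (simp add: scaleR_conv_of_real)

lemma norm_integral_cis_le:
  assumes "c \<noteq> 0" "0 \<le> R"
  shows "norm (integral {-R..R} (\<lambda>x. cis (c * x + e))) \<le> 2 / \<bar>c\<bar>"
proof -
  have "((\<lambda>x. cis (c * x + e)) has_integral
      (cis (c * R + e) / (\<i> * c) - cis (c * (-R) + e) / (\<i> * c))) {-R..R}"
    by (rule fundamental_theorem_of_calculus)
      (use assms in \<open>auto simp: has_vector_derivative_def scaleR_conv_of_real
         fun_eq_iff complex_eq_iff intro!: derivative_eq_intros\<close>)
  then have "integral {-R..R} (\<lambda>x. cis (c * x + e)) = (cis (c * R + e) - cis (c * (-R) + e)) / (\<i> * c)"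
    by (simp add: integral_unique diff_divide_distrib)
  moreover have "norm (cis (c * R + e) - cis (c * (-R) + e)) \<le> 2"
    using norm_triangle_ineq4[of "cis (c * R + e)" "cis (c * (-R) + e)"] by simp
  ultimately show ?thesis
    by (simp add: norm_divide norm_mult divide_right_mono)
qed

definition sinc_fourier_int :: "real \<Rightarrow> real \<Rightarrow> real \<Rightarrow> real \<Rightarrow> complex" where
  "sinc_fourier_int a b R \<omega> =
     integral {-R..R} (\<lambda>x. complex_of_real (sinc (a * (x - b))) * cis (- (\<omega> * x)))"

text \<open>At frequencies far outside the band, write the sinc function as an average of the waves with
  frequencies in \<open>[-a, a]\<close> and integrate over \<open>x\<close> first. Every wave then differs from the frequency
  \<open>\<omega>\<close> by at least \<open>|\<omega>|/2\<close>, hence contributes at most \<open>4/|\<omega>|\<close>, whatever the truncation.\<close>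

lemma sinc_fourier_int_decay:
  assumes a: "0 < a" and R: "0 \<le> R" and w: "2 * a \<le> \<bar>\<omega>\<bar>"
  shows "norm (sinc_fourier_int a b R \<omega>) \<le> 4 / \<bar>\<omega>\<bar>"
proof -
  define h where "h x t = cis ((a * t - \<omega>) * x + (- a * b * t))" for x t
  have cont: "continuous_on (cbox (- R, - 1) (R, 1)) (\<lambda>(x, t). h x t)"
    unfolding h_def case_prod_beta by (intro continuous_intros)
  have "sinc_fourier_int a b R \<omega> = integral {-R..R} (\<lambda>x. integral {-1..1} (h x) / 2)"
    unfolding sinc_fourier_int_def
  proof (rule integral_cong)
    fix x
    have "complex_of_real (sinc (a * (x - b))) * cis (- (\<omega> * x)) =
        integral {-1..1} (\<lambda>t. cis (a * (x - b) * t)) / 2 * cis (- (\<omega> * x))"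
      by (subst sinc_eq_integral_cis) simp
    also have "\<dots> = integral {-1..1} (\<lambda>t. cis (a * (x - b) * t) * cis (- (\<omega> * x))) / 2"
      by simp
    also have "(\<lambda>t. cis (a * (x - b) * t) * cis (- (\<omega> * x))) = h x"
      by (simp add: h_def cis_mult fun_eq_iff algebra_simps)
    finally show "complex_of_real (sinc (a * (x - b))) * cis (- (\<omega> * x)) = integral {-1..1} (h x) / 2" .
  qed
  also have "\<dots> = integral {-R..R} (\<lambda>x. integral {-1..1} (h x)) / 2"
    by simp
  also have "integral {-R..R} (\<lambda>x. integral {-1..1} (h x)) =
      integral {-1..1} (\<lambda>t. integral {-R..R} (\<lambda>x. h x t))"
    using integral_swap_continuous[OF cont] by simp
  finally have eq: "sinc_fourier_int a b R \<omega> = integral {-1..1} (\<lambda>t. integral {-R..R} (\<lambda>x. h x t)) / 2" .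
  have "norm (integral {-1..1} (\<lambda>t. integral {-R..R} (\<lambda>x. h x t))) \<le> (4 / \<bar>\<omega>\<bar>) * (1 - (-1))"
  proof (rule integral_bound)
    show "continuous_on {-1..1} (\<lambda>t. integral {-R..R} (\<lambda>x. h x t))"
      unfolding cbox_interval[symmetric]
      by (rule integral_continuous_on_param) (simp add: h_def case_prod_beta; intro continuous_intros)
    fix t :: real assume t: "t \<in> {-1..1}"
    have "\<bar>a * t\<bar> \<le> a * 1"
      unfolding abs_mult using a t by (intro mult_mono) auto
    with w a have le: "\<bar>\<omega>\<bar> / 2 \<le> \<bar>a * t - \<omega>\<bar>" and nz: "a * t - \<omega> \<noteq> 0"
      by linarith+
    have "norm (integral {-R..R} (\<lambda>x. h x t)) \<le> 2 / \<bar>a * t - \<omega>\<bar>"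
      unfolding h_def by (rule norm_integral_cis_le[OF nz R])
    also have "\<dots> \<le> 2 / (\<bar>\<omega>\<bar> / 2)"
      using le w a nz by (intro divide_left_mono) auto
    finally show "norm (integral {-R..R} (\<lambda>x. h x t)) \<le> 4 / \<bar>\<omega>\<bar>" by simp
  qed simp
  then show ?thesis unfolding eq by (simp add: norm_divide)
qed

text \<open>For a sinc function centred in the window, the imaginary part vanishes by symmetry, and
  \<open>2 sin(ax) cos(\<omega>x) = sin((a-\<omega>)x) + sin((a+\<omega>)x)\<close> turns the real part into sine integrals.\<close>

lemma sinc_fourier_int_centered:
  assumes a: "0 < a" and R: "0 \<le> R"
  shows "sinc_fourier_int a 0 R \<omega> = complex_of_real ((Si ((a - \<omega>) * R) + Si ((a + \<omega>) * R)) / a)"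
proof -
  let ?q = "\<lambda>x. complex_of_real (sinc (a * x)) * cis (- (\<omega> * x))"
  have int: "?q integrable_on {-R..R}"
    by (intro integrable_continuous_real continuous_intros)
  define G where "G x = (Si ((a - \<omega>) * x) + Si ((a + \<omega>) * x)) / (2 * a)" for x
  have neg: "Si (- x) = - Si x" for x
    using Si_neg[of x] Si_neg[of "-x"] by (cases "x \<ge> 0") auto
  have "((\<lambda>x. sinc (a * x) * cos (\<omega> * x)) has_integral (G R - G (- R))) {-R..R}"
  proof (rule fundamental_theorem_of_calculus)
    fix x assume "x \<in> {-R..R}"
    have "(G has_real_derivative
        (sinc ((a - \<omega>) * x) * (a - \<omega>) + sinc ((a + \<omega>) * x) * (a + \<omega>)) / (2 * a)) (at x)"
      unfolding G_def
      by (intro DERIV_cdivide DERIV_add DERIV_chain2[OF DERIV_Si] DERIV_cmult_Id)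
    also have "(sinc ((a - \<omega>) * x) * (a - \<omega>) + sinc ((a + \<omega>) * x) * (a + \<omega>)) / (2 * a)
        = sinc (a * x) * cos (\<omega> * x)"
    proof (cases "x = 0")
      case False
      have "x * (sinc ((a - \<omega>) * x) * (a - \<omega>) + sinc ((a + \<omega>) * x) * (a + \<omega>)) =
          ((a - \<omega>) * x) * sinc ((a - \<omega>) * x) + ((a + \<omega>) * x) * sinc ((a + \<omega>) * x)"
        by (simp only: algebra_simps)
      also have "\<dots> = sin ((a - \<omega>) * x) + sin ((a + \<omega>) * x)"
        by (simp only: mult_sinc)
      also have "\<dots> = 2 * sin (a * x) * cos (\<omega> * x)"
        by (simp add: left_diff_distrib distrib_right sin_add sin_diff)
      also have "sin (a * x) = a * x * sinc (a * x)"
        by (simp only: mult_sinc)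
      finally have "x * (sinc ((a - \<omega>) * x) * (a - \<omega>) + sinc ((a + \<omega>) * x) * (a + \<omega>)) =
          2 * (a * x * sinc (a * x)) * cos (\<omega> * x)" .
      moreover have "S / (2 * a) = k * c" if "x * S = 2 * (a * x * k) * c" for S k c
        using that False a by (simp add: field_simps)
      ultimately show ?thesis by blast
    qed (use a in auto)
    finally show "(G has_vector_derivative sinc (a * x) * cos (\<omega> * x)) (at x within {-R..R})"
      by (simp only: has_real_derivative_iff_has_vector_derivative[symmetric] has_field_derivative_at_within)
  qed (use R in simp)
  moreover have "G R - G (- R) = (Si ((a - \<omega>) * R) + Si ((a + \<omega>) * R)) / a"
  proof -
    have "(p + q) / (2 * a) - (- p + - q) / (2 * a) = (p + q) / a" for p q
      using a by (simp add: field_simps)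
    then show ?thesis by (simp only: G_def mult_minus_right neg)
  qed
  ultimately have 1: "integral {-R..R} (\<lambda>x. sinc (a * x) * cos (\<omega> * x)) =
     (Si ((a - \<omega>) * R) + Si ((a + \<omega>) * R)) / a"
    by (simp only: integral_unique)
  have "integral {-R..R} (\<lambda>x. sinc (a * (-x)) * sin (\<omega> * (-x))) = integral {-R..R} (\<lambda>x. sinc (a * x) * sin (\<omega> * x))"
    using Henstock_Kurzweil_Integration.integral_reflect_real[of R "-R" "\<lambda>x. sinc (a * x) * sin (\<omega> * x)"] by (simp only: minus_minus)
  also have "(\<lambda>x. sinc (a * (-x)) * sin (\<omega> * (-x))) = (\<lambda>x. - (sinc (a * x) * sin (\<omega> * x)))"
    by (rule ext) simp
  finally have 2: "integral {-R..R} (\<lambda>x. sinc (a * x) * sin (\<omega> * x)) = 0"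
    by simp
  have re: "Re (integral {-R..R} ?q) = integral {-R..R} (\<lambda>x. sinc (a * x) * cos (\<omega> * x))"
    by (subst integral_unique[OF has_integral_Re[OF integrable_integral[OF int]], symmetric]) (simp only: times_complex.sel Re_complex_of_real Im_complex_of_real mult_zero_left diff_zero cis.sel cos_minus)
  have im: "Im (integral {-R..R} ?q) = - integral {-R..R} (\<lambda>x. sinc (a * x) * sin (\<omega> * x))"
    by (subst integral_unique[OF has_integral_Im[OF integrable_integral[OF int]], symmetric]) (simp only: integral_neg[symmetric] times_complex.sel Re_complex_of_real Im_complex_of_real mult_zero_left add_0_right cis.sel sin_minus mult_minus_right)
  show ?thesis
    unfolding sinc_fourier_int_def diff_zero
    by (rule complex_eqI) (simp_all only: re im 1 2, simp_all)
qed

text \<open>Moving the centre from \<open>0\<close> to \<open>b\<close> amounts, up to the phase \<open>e\<^sup>-\<^sup>i\<^sup>\<omega>\<^sup>b\<close>, to shifting the window.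
  This changes the integral only over two pieces of length \<open>|b|\<close> near the ends \<open>-R\<close> and \<open>R\<close>. Any
  bound on the sinc function there suffices: \<open>1\<close> yields a bound uniform in \<open>R\<close>, and the decay like
  \<open>1/R\<close> yields the limit.\<close>

lemma sinc_fourier_int_shift:
  assumes a: "0 < a" and R: "0 \<le> R"
  assumes B: "\<And>x. R - \<bar>b\<bar> \<le> \<bar>x\<bar> \<Longrightarrow> \<bar>sinc (a * x)\<bar> \<le> B"
  shows "norm (cis (\<omega> * b) * sinc_fourier_int a b R \<omega> - sinc_fourier_int a 0 R \<omega>) \<le> 2 * B * \<bar>b\<bar>"
proof -
  let ?q = "\<lambda>x. complex_of_real (sinc (a * x)) * cis (- (\<omega> * x))"
  let ?I = "{- (R + \<bar>b\<bar>)..R + \<bar>b\<bar>}"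
  have "continuous_on ?I ?q"
    by (intro continuous_intros)
  then obtain P where P: "\<And>x. x \<in> ?I \<Longrightarrow> (P has_vector_derivative ?q x) (at x within ?I)"
    using antiderivative_continuous[of "- (R + \<bar>b\<bar>)" "R + \<bar>b\<bar>" ?q] by blast
  \<comment> \<open>Working with a primitive \<open>P\<close> makes the sign of \<open>b\<close> irrelevant: both end pieces are increments of \<open>P\<close>.\<close>
  have ftc: "integral {c..d} ?q = P d - P c" if "c \<le> d" "{c..d} \<subseteq> ?I" for c d
    by (intro integral_unique fundamental_theorem_of_calculus that has_vector_derivative_within_subset[OF P])
      (use that in auto)
  have "cis (\<omega> * b) * sinc_fourier_int a b R \<omega> = integral {-R..R} (\<lambda>x. ?q (x - b))"
    unfolding sinc_fourier_int_def integral_mult_right[symmetric]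
    by (intro integral_cong)
      (simp only: mult.left_commute[of "cis _"] cis_mult, simp add: algebra_simps)
  also have "\<dots> = integral {-R - b..R - b} ?q"
    using integral_shift_real_ivl[of "-R - b" "-b" "R - b" ?q] by (simp only: diff_minus_eq_add diff_add_cancel add_uminus_conv_diff)
  also have "\<dots> = P (R - b) - P (-R - b)"
    using R by (intro ftc) auto
  finally have 1: "cis (\<omega> * b) * sinc_fourier_int a b R \<omega> = P (R - b) - P (-R - b)" .
  have 2: "sinc_fourier_int a 0 R \<omega> = P R - P (-R)"
    unfolding sinc_fourier_int_def diff_zero using R by (intro ftc) auto
  have bd: "norm (P (x - b) - P x) \<le> B * \<bar>b\<bar>" if x: "\<bar>x\<bar> = R" for x
  proof -
    have S: "closed_segment x (x - b) \<subseteq> ?I"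
      using x by (auto simp: closed_segment_eq_real_ivl split: if_splits)
    have "norm (P (x - b) - P x) \<le> B * norm (x - b - x)"
    proof (rule differentiable_bound[OF convex_closed_segment])
      fix y assume "y \<in> closed_segment x (x - b)"
      then have "(P has_vector_derivative ?q y) (at y within closed_segment x (x - b))"
        using S by (intro has_vector_derivative_within_subset[OF P]) auto
      then show "(P has_derivative (\<lambda>h. h *\<^sub>R ?q y)) (at y within closed_segment x (x - b))"
        by (simp only: has_vector_derivative_def)
    next
      fix y assume y: "y \<in> closed_segment x (x - b)"
      then have "R - \<bar>b\<bar> \<le> \<bar>y\<bar>"
        using x by (auto simp: closed_segment_eq_real_ivl split: if_splits)
      then have "norm (?q y) \<le> B"
        using B[of y] by (simp only: norm_mult norm_of_real norm_cis mult_1_right)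
      then show "onorm (\<lambda>h. h *\<^sub>R ?q y) \<le> B"
        by (simp only: onorm_scaleR_left[OF bounded_linear_ident] onorm_id mult_1_left)
    qed auto
    then show ?thesis by simp
  qed
  have "norm (P (R - b) - P (-R - b) - (P R - P (-R))) \<le> norm (P (R - b) - P R) + norm (P (- R - b) - P (- R))"
    using norm_triangle_ineq4[of "P (R - b) - P R" "P (- R - b) - P (- R)"] by (simp add: algebra_simps)
  also have "\<dots> \<le> B * \<bar>b\<bar> + B * \<bar>b\<bar>"
    using bd[of R] bd[of "-R"] R by (intro add_mono) auto
  finally show ?thesis
    unfolding 1 2 by simp
qed

lemma sinc_fourier_int_bounded:
  assumes a: "0 < a"
  shows "\<exists>B. \<forall>R\<ge>0. \<forall>\<omega>. norm (sinc_fourier_int a b R \<omega>) \<le> B"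
proof -
  obtain B where B: "\<And>T. \<bar>Si T\<bar> \<le> B"
    using bounded_Si by auto
  show ?thesis
  proof (intro exI allI impI)
    fix R \<omega> :: real assume R: "0 \<le> R"
    have "norm (cis (\<omega> * b) * sinc_fourier_int a b R \<omega> - sinc_fourier_int a 0 R \<omega>) \<le> 2 * 1 * \<bar>b\<bar>"
      by (rule sinc_fourier_int_shift[OF a R abs_sinc_le_1])
    moreover have "norm (sinc_fourier_int a 0 R \<omega>) \<le> (B + B) / a"
      unfolding sinc_fourier_int_centered[OF a R] norm_of_real abs_divide
      using a by (intro frac_le order_trans[OF abs_triangle_ineq add_mono] B) (use B[of 0] in auto)
    ultimately have "norm (cis (\<omega> * b) * sinc_fourier_int a b R \<omega>) \<le> 2 * \<bar>b\<bar> + (B + B) / a"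
      using norm_triangle_sub[of "cis (\<omega> * b) * sinc_fourier_int a b R \<omega>" "sinc_fourier_int a 0 R \<omega>"] by linarith
    then show "norm (sinc_fourier_int a b R \<omega>) \<le> 2 * \<bar>b\<bar> + (B + B) / a"
      by (simp only: norm_mult norm_cis mult_1_left)
  qed
qed

lemma Si_scaled_at_top: "((\<lambda>R. Si (c * R)) \<longlongrightarrow> sgn c * (pi / 2)) at_top"
proof -
  consider "c > 0" | "c = 0" | "c < 0" by linarith
  then show ?thesis
  proof cases
    case 1
    then have "filterlim (\<lambda>R. c * R) at_top at_top"
      by (intro filterlim_tendsto_pos_mult_at_top[OF tendsto_const _ filterlim_ident])
    from filterlim_compose[OF Si_at_top this] 1 show ?thesis by simp
  next
    case 2
    have "Si 0 = 0" using Si_neg[of 0] by simp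
    with 2 show ?thesis by simp
  next
    case 3
    then have "filterlim (\<lambda>R. - c * R) at_top at_top"
      by (intro filterlim_tendsto_pos_mult_at_top[OF tendsto_const _ filterlim_ident]) auto
    from tendsto_minus[OF filterlim_compose[OF Si_at_top this]]
    have "((\<lambda>R. - Si (- c * R)) \<longlongrightarrow> - (pi / 2)) at_top" .
    moreover have "\<forall>\<^sub>F R in at_top. - Si (- c * R) = Si (c * R)"
      using eventually_ge_at_top[of 0]
    proof eventually_elim
      fix R :: real assume "0 \<le> R"
      then have "0 \<le> - c * R" using 3 by (intro mult_nonneg_nonneg) auto
      from Si_neg[OF this] show "- Si (- c * R) = Si (c * R)" by simp
    qed
    ultimately have "((\<lambda>R. Si (c * R)) \<longlongrightarrow> - (pi / 2)) at_top"
      by (rule Lim_transform_eventually)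
    then show ?thesis using 3 by simp
  qed
qed

text \<open>By the centred formula the limit is, up to the phase, \<open>\<pi>/(2a)\<close> times \<open>sgn(a-\<omega>) + sgn(a+\<omega>)\<close>: the two signs add up
  to \<open>2\<close> inside the band and cancel outside.\<close>

lemma sinc_fourier_int_tendsto:
  assumes a: "0 < a" and w: "\<bar>\<omega>\<bar> \<noteq> a"
  shows "((\<lambda>R. sinc_fourier_int a b R \<omega>) \<longlongrightarrow>
     (if \<bar>\<omega>\<bar> \<le> a then complex_of_real (pi / a) * cis (- (\<omega> * b)) else 0)) at_top"
proof -
  have "((\<lambda>R. complex_of_real ((Si ((a - \<omega>) * R) + Si ((a + \<omega>) * R)) / a)) \<longlongrightarrow>
     complex_of_real ((sgn (a - \<omega>) * (pi / 2) + sgn (a + \<omega>) * (pi / 2)) / a)) at_top"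
    by (intro tendsto_intros Si_scaled_at_top) (use a in auto)
  also have "(sgn (a - \<omega>) * (pi / 2) + sgn (a + \<omega>) * (pi / 2)) / a = (if \<bar>\<omega>\<bar> \<le> a then pi / a else 0)"
    using a w by (auto simp: sgn_if abs_if split: if_splits)
  finally have 0: "((\<lambda>R. sinc_fourier_int a 0 R \<omega>) \<longlongrightarrow> complex_of_real (if \<bar>\<omega>\<bar> \<le> a then pi / a else 0)) at_top"
    by (rule Lim_transform_eventually)
      (use eventually_ge_at_top[of 0] in \<open>eventually_elim, simp add: sinc_fourier_int_centered[OF a]\<close>)
  have "((\<lambda>R. cis (\<omega> * b) * sinc_fourier_int a b R \<omega> - sinc_fourier_int a 0 R \<omega>) \<longlongrightarrow> 0) at_top"
  proof (rule Lim_null_comparison)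
    show "\<forall>\<^sub>F R in at_top. norm (cis (\<omega> * b) * sinc_fourier_int a b R \<omega> - sinc_fourier_int a 0 R \<omega>)
        \<le> 2 * (1 / (a * (R - \<bar>b\<bar>))) * \<bar>b\<bar>"
      using eventually_gt_at_top[of "\<bar>b\<bar>"]
    proof eventually_elim
      fix R assume R: "\<bar>b\<bar> < R"
      show "norm (cis (\<omega> * b) * sinc_fourier_int a b R \<omega> - sinc_fourier_int a 0 R \<omega>)
        \<le> 2 * (1 / (a * (R - \<bar>b\<bar>))) * \<bar>b\<bar>"
      proof (rule sinc_fourier_int_shift[OF a])
        fix x assume x: "R - \<bar>b\<bar> \<le> \<bar>x\<bar>"
        have "\<bar>sinc (a * x)\<bar> = \<bar>sin (a * x)\<bar> / (a * \<bar>x\<bar>)"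
          using x R a by (auto simp: abs_mult)
        also have "\<dots> \<le> 1 / (a * (R - \<bar>b\<bar>))"
          using x R a by (intro frac_le) auto
        finally show "\<bar>sinc (a * x)\<bar> \<le> 1 / (a * (R - \<bar>b\<bar>))" .
      qed (use R in auto)
    qed
    have "filterlim (\<lambda>R. a * (R - \<bar>b\<bar>)) at_top at_top"
      using filterlim_tendsto_pos_mult_at_top[OF tendsto_const a
          filterlim_tendsto_add_at_top[OF tendsto_const[of "- \<bar>b\<bar>"] filterlim_ident]]
      by simp
    then show "((\<lambda>R. 2 * (1 / (a * (R - \<bar>b\<bar>))) * \<bar>b\<bar>) \<longlongrightarrow> 0) at_top"
      by (intro tendsto_mult_left_zero tendsto_mult_right_zero tendsto_mult_left_zero real_tendsto_divide_at_top[OF tendsto_const])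
  qed
  from tendsto_mult[OF tendsto_const[of "cis (- (\<omega> * b))"] tendsto_add[OF this 0]]
  have "((\<lambda>R. cis (- (\<omega> * b)) * (cis (\<omega> * b) * sinc_fourier_int a b R \<omega>)) \<longlongrightarrow>
    cis (- (\<omega> * b)) * complex_of_real (if \<bar>\<omega>\<bar> \<le> a then pi / a else 0)) at_top"
    by simp
  then show ?thesis
    by (simp add: mult.assoc[symmetric] cis_mult mult.commute split: if_splits)
qed

text \<open>The weight \<open>1/(1+|x|)\<close> is the common majorant for everything below. A quantity is dominated by a
  multiple of it as soon as it is bounded and is at most \<open>c/|x|\<close> for large \<open>|x|\<close>.\<close>

lemma le_weightI:
  fixes x y :: real
  assumes "y \<le> B" "0 \<le> y" "0 \<le> m" "0 \<le> c" "m \<le> \<bar>x\<bar> \<Longrightarrow> y * \<bar>x\<bar> \<le> c"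
  shows "y \<le> (B + B * m + c) * (1 / (1 + \<bar>x\<bar>))"
proof -
  have "y * \<bar>x\<bar> \<le> B * m + c"
  proof (cases "m \<le> \<bar>x\<bar>")
    case True
    then show ?thesis using assms mult_nonneg_nonneg[of B m] by linarith
  next
    case False
    then have "y * \<bar>x\<bar> \<le> B * m" using assms by (intro mult_mono) auto
    then show ?thesis using assms by linarith
  qed
  then have "y * (1 + \<bar>x\<bar>) \<le> B + B * m + c" using assms by (simp add: algebra_simps)
  then show ?thesis by (simp add: field_simps)
qed

lemma sinc_fourier_int_le_weight:
  assumes a: "0 < a"
  shows "\<exists>C. \<forall>R\<ge>0. \<forall>\<omega>. norm (sinc_fourier_int a b R \<omega>) \<le> C * (1 / (1 + \<bar>\<omega>\<bar>))"
proof -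
  obtain B where B: "\<And>R \<omega>. 0 \<le> R \<Longrightarrow> norm (sinc_fourier_int a b R \<omega>) \<le> B"
    using sinc_fourier_int_bounded[OF a] by blast
  show ?thesis
  proof (intro exI allI impI)
    fix R \<omega> :: real assume R: "0 \<le> R"
    show "norm (sinc_fourier_int a b R \<omega>) \<le> (B + B * (2 * a) + 4) * (1 / (1 + \<bar>\<omega>\<bar>))"
    proof (rule le_weightI[OF B[OF R]])
      show "norm (sinc_fourier_int a b R \<omega>) * \<bar>\<omega>\<bar> \<le> 4" if "2 * a \<le> \<bar>\<omega>\<bar>"
        using sinc_fourier_int_decay[OF a R that, of b] a that by (simp add: field_simps)
    qed (use a in auto)
  qed
qed

lemma sinc_le_weight:
  assumes a: "0 < a"
  shows "\<exists>C. \<forall>x. \<bar>sinc (a * (x - b))\<bar> \<le> C * (1 / (1 + \<bar>x\<bar>))"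
proof (intro exI allI)
  fix x
  show "\<bar>sinc (a * (x - b))\<bar> \<le> (1 + 1 * (2 * \<bar>b\<bar> + 1) + 2 / a) * (1 / (1 + \<bar>x\<bar>))"
  proof (rule le_weightI[OF abs_sinc_le_1])
    assume x: "2 * \<bar>b\<bar> + 1 \<le> \<bar>x\<bar>"
    then have le: "\<bar>x\<bar> \<le> 2 * \<bar>x - b\<bar>"
      using abs_triangle_ineq[of "x - b" b] by simp
    have "\<bar>sinc (a * (x - b))\<bar> * \<bar>x\<bar> \<le> \<bar>sinc (a * (x - b))\<bar> * (2 * \<bar>x - b\<bar>)"
      by (intro mult_left_mono) (use le in simp_all)
    also have "\<dots> = 2 * \<bar>(a * (x - b)) * sinc (a * (x - b))\<bar> / a"
      using a by (simp only: abs_mult) simp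
    also have "\<dots> = 2 * \<bar>sin (a * (x - b))\<bar> / a"
      by (simp only: mult_sinc)
    also have "\<dots> \<le> 2 * 1 / a"
      using a by (intro divide_right_mono mult_left_mono) auto
    finally show "\<bar>sinc (a * (x - b))\<bar> * \<bar>x\<bar> \<le> 2 / a" by simp
  qed (use a in auto)
qed

lemma integrable_weight_square: "integrable lborel (\<lambda>x::real. (1 / (1 + \<bar>x\<bar>))\<^sup>2)"
proof (rule Bochner_Integration.integrable_bound)
  show "integrable lborel (\<lambda>x::real. inverse (1 + x\<^sup>2))"
    using integrable_inverse_1_plus_square by (simp add: set_integrable_def)
  have "inverse ((1 + \<bar>x\<bar>)\<^sup>2) \<le> inverse (1 + x\<^sup>2)" for x :: real
    by (intro le_imp_inverse_le) (auto simp: power2_eq_square algebra_simps intro: add_pos_nonneg)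
  then show "AE x in lborel. norm ((1 / (1 + \<bar>x::real\<bar>))\<^sup>2) \<le> norm (inverse (1 + x\<^sup>2))"
    by (simp add: power_divide divide_inverse power_inverse)
qed auto

section \<open>Products over the coordinates\<close>

text \<open>Lebesgue measure on \<open>\<real>\<^sup>d\<close> as a product measure indexed by the coordinates rather than by the
  basis vectors, so that integrals of products of functions of one coordinate factor.\<close>

lemma lborel_vec_eq_distr:
  "lborel = distr (Pi\<^sub>M (UNIV :: 'd::finite set) (\<lambda>_. lborel :: real measure)) borel (\<lambda>f. \<chi> i. f i)"
  (is "_ = distr ?P borel ?v")
proof (rule lborel_eqI)
  interpret product_sigma_finite "\<lambda>_::'d. lborel :: real measure"
    by (simp add: product_sigma_finite_def sigma_finite_lborel)
  have v[measurable]: "?v \<in> measurable ?P borel"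
    by (rule borel_measurable_euclidean_space[THEN iffD2])
       (auto simp: Basis_vec_def inner_axis)
  show "sets (distr ?P borel ?v) = sets borel" by simp
  fix l u :: "real ^ 'd"
  assume le: "\<And>b. b \<in> Basis \<Longrightarrow> l \<bullet> b \<le> u \<bullet> b"
  have le': "l $ i \<le> u $ i" for i
    using le[of "axis i 1"] by (auto simp: inner_axis Basis_vec_def)
  have "emeasure (distr ?P borel ?v) (box l u) = emeasure ?P (\<Pi>\<^sub>E i\<in>UNIV. {l $ i <..< u $ i})"
    by (subst emeasure_distr)
       (auto simp: space_PiM mem_box Basis_vec_def inner_axis PiE_UNIV_domain Pi_iff intro!: arg_cong2[where f=emeasure])
  also have "\<dots> = (\<Prod>i\<in>UNIV. ennreal (u $ i - l $ i))"
    by (subst emeasure_PiM) (auto simp: le')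
  also have "\<dots> = ennreal (\<Prod>i\<in>UNIV. u $ i - l $ i)"
    by (intro prod_ennreal) (simp add: le')
  also have "(\<Prod>i\<in>UNIV. u $ i - l $ i) = (\<Prod>b\<in>Basis. (u - l) \<bullet> b)"
    by (rule prod.reindex_bij_witness[of _ "\<lambda>b. THE i. b = axis i 1" "\<lambda>i. axis i 1"])
       (auto simp: Basis_vec_def inner_axis axis_eq_axis)
  finally show "emeasure (distr ?P borel ?v) (box l u) = (\<Prod>b\<in>Basis. (u - l) \<bullet> b)" .
qed

lemma
  fixes f :: "'d::finite \<Rightarrow> real \<Rightarrow> 'b::{real_normed_field,banach,second_countable_topology}"
  assumes f: "\<And>i. integrable lborel (f i)"
  shows integrable_lborel_vec_prod: "integrable lborel (\<lambda>x::real^'d. \<Prod>i\<in>UNIV. f i (x $ i))"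
    and integral_lborel_vec_prod:
      "(LINT x|lborel. (\<Prod>i\<in>UNIV. f i ((x::real^'d) $ i))) = (\<Prod>i\<in>UNIV. (LINT t|lborel. f i t))"
proof -
  interpret product_sigma_finite "\<lambda>_::'d. lborel :: real measure"
    by (simp add: product_sigma_finite_def sigma_finite_lborel)
  have [measurable]: "f i \<in> borel_measurable borel" for i
    using borel_measurable_integrable[OF f[of i]] by simp
  have v[measurable]: "(\<lambda>f. \<chi> i. f i) \<in> measurable (Pi\<^sub>M (UNIV :: 'd::finite set) (\<lambda>_. lborel :: real measure)) borel"
    by (rule borel_measurable_euclidean_space[THEN iffD2])
       (auto simp: Basis_vec_def inner_axis)
  have [measurable]: "(\<lambda>x::real^'d. x $ i) \<in> borel_measurable borel" for i
    by (intro borel_measurable_continuous_onI continuous_intros)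
  show "integrable lborel (\<lambda>x::real^'d. \<Prod>i\<in>UNIV. f i (x $ i))"
    unfolding lborel_vec_eq_distr
    by (subst integrable_distr_eq) (use product_integrable_prod[OF finite f] in auto)
  show "(LINT x|lborel. (\<Prod>i\<in>UNIV. f i ((x::real^'d) $ i))) = (\<Prod>i\<in>UNIV. (LINT t|lborel. f i t))"
    unfolding lborel_vec_eq_distr[where 'd='d]
    by (subst integral_distr) (use product_integral_prod[OF finite f] in auto)
qed

definition vec_weight :: "real ^ 'd \<Rightarrow> real" where
  "vec_weight x = (\<Prod>i\<in>UNIV. 1 / (1 + \<bar>x $ i\<bar>))"

lemma borel_measurable_vec_nth [measurable]: "(\<lambda>x::real^'d. x $ i) \<in> borel_measurable borel"
  by (intro borel_measurable_continuous_onI continuous_intros)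

lemma integrable_vec_weight_square: "integrable lborel (\<lambda>x :: real^'d. (vec_weight x)\<^sup>2)"
  unfolding vec_weight_def prod_power_distrib
  by (rule integrable_lborel_vec_prod[OF integrable_weight_square])

lemma prod_le_vec_weight:
  fixes f :: "'d::finite \<Rightarrow> real \<Rightarrow> real"
  assumes "\<And>i t. 0 \<le> f i t" "\<And>i t. f i t \<le> C i * (1 / (1 + \<bar>t\<bar>))"
  shows "(\<Prod>i\<in>UNIV. f i (x $ i)) \<le> (\<Prod>i\<in>UNIV. C i) * vec_weight x"
  unfolding vec_weight_def prod.distrib[symmetric] using assms by (intro prod_mono) blast

text \<open>For the exclusion of the band edges, where the truncated Fourier integrals do not converge to the
  spectrum: coordinate hyperplanes are negligible.\<close>

lemma AE_vec_nth_neq: "AE x::real^'d in lborel. \<forall>i. x $ i \<noteq> c i"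
proof -
  have "AE x::real^'d in lborel. x $ i \<noteq> c i" for i
  proof -
    have "negligible {x::real^'d. x $ i = c i}"
      using negligible_standard_hyperplane[of "axis i (1::real)" "c i"] by (simp add: cart_eq_inner_axis axis_in_Basis_iff)
    then have "{x::real^'d. x $ i = c i} \<in> null_sets lebesgue"
      by (simp add: negligible_iff_null_sets)
    moreover have "{x::real^'d. x $ i = c i} \<in> sets borel"
      by measurable
    ultimately have "{x::real^'d. x $ i = c i} \<in> null_sets lborel"
      by (simp add: null_sets_def)
    then show ?thesis by (rule AE_I') auto
  qed
  then show ?thesis by (simp add: AE_all_countable)
qed

section \<open>Fourier transforms in the sense of truncated integrals\<close>

lemma borel_measurable_cis [measurable]:
  "f \<in> borel_measurable M \<Longrightarrow> (\<lambda>x. cis (f x)) \<in> borel_measurable M"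
  by (simp add: cis_conv_exp)

lemma borel_measurable_truncated_fourier [measurable]:
  fixes v :: "real ^ 'd \<Rightarrow> complex"
  assumes [measurable]: "v \<in> borel_measurable lborel"
  shows "truncated_fourier R v \<in> borel_measurable lborel"
proof -
  have [measurable]: "v \<in> borel_measurable borel"
    using assms by simp
  show ?thesis
    unfolding truncated_fourier_def[abs_def] set_lebesgue_integral_def
    by measurable
qed

text \<open>Two limits of the same net in \<open>L\<^sup>2\<close> agree: \<open>|g - h|\<^sup>2\<close> is at most twice the sum of the squared
  distances of \<open>g\<close> and of \<open>h\<close> to the truncated transforms, and these tend to \<open>0\<close> in mean.\<close>

lemma is_fourier_transform_unique:
  fixes v :: "real ^ 'd \<Rightarrow> complex"
  assumes g: "is_fourier_transform v g" and h: "is_fourier_transform v h"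
  shows "AE \<omega> in lborel. g \<omega> = h \<omega>"
proof -
  have [measurable]: "v \<in> borel_measurable borel" "g \<in> borel_measurable borel" "h \<in> borel_measurable borel"
    using g h by (auto simp: is_fourier_transform_def square_integrable_def)
  have [measurable]: "truncated_fourier R v \<in> borel_measurable borel" for R
    using borel_measurable_truncated_fourier[of v R] by simp
  let ?D = "\<lambda>f R. \<integral>\<^sup>+ \<omega>. ennreal ((cmod (truncated_fourier R v \<omega> - f \<omega>))\<^sup>2) \<partial>lborel"
  let ?I = "\<integral>\<^sup>+ \<omega>. ennreal ((cmod (g \<omega> - h \<omega>))\<^sup>2) \<partial>lborel"
  have le: "?I \<le> 2 * ?D g R + 2 * ?D h R" for R
  proof -
    have "?I \<le> (\<integral>\<^sup>+ \<omega>. 2 * ennreal ((cmod (truncated_fourier R v \<omega> - g \<omega>))\<^sup>2) +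
        2 * ennreal ((cmod (truncated_fourier R v \<omega> - h \<omega>))\<^sup>2) \<partial>lborel)"
    proof (rule nn_integral_mono)
      fix \<omega>
      let ?t = "truncated_fourier R v \<omega>"
      have "cmod (g \<omega> - h \<omega>) \<le> cmod (?t - g \<omega>) + cmod (?t - h \<omega>)"
        using norm_triangle_ineq4[of "?t - h \<omega>" "?t - g \<omega>"] by simp
      then have "(cmod (g \<omega> - h \<omega>))\<^sup>2 \<le> (cmod (?t - g \<omega>) + cmod (?t - h \<omega>))\<^sup>2"
        by (intro power_mono) auto
      also have "\<dots> \<le> 2 * (cmod (?t - g \<omega>))\<^sup>2 + 2 * (cmod (?t - h \<omega>))\<^sup>2"
        using sum_squares_bound[of "cmod (?t - g \<omega>)" "cmod (?t - h \<omega>)"] by (simp add: power2_sum)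
      finally have "ennreal ((cmod (g \<omega> - h \<omega>))\<^sup>2) \<le> ennreal (2 * (cmod (?t - g \<omega>))\<^sup>2 + 2 * (cmod (?t - h \<omega>))\<^sup>2)"
        by (rule ennreal_leI)
      then show "ennreal ((cmod (g \<omega> - h \<omega>))\<^sup>2) \<le> 2 * ennreal ((cmod (?t - g \<omega>))\<^sup>2) + 2 * ennreal ((cmod (?t - h \<omega>))\<^sup>2)"
        by (simp add: ennreal_plus ennreal_mult)
    qed
    also have "\<dots> = 2 * ?D g R + 2 * ?D h R"
      by (simp add: nn_integral_add nn_integral_cmult)
    finally show ?thesis .
  qed
  have "((\<lambda>R. 2 * ?D g R + 2 * ?D h R) \<longlongrightarrow> 2 * 0 + 2 * 0) at_top"
    using g h unfolding is_fourier_transform_def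
    by (intro tendsto_add ennreal_tendsto_cmult) auto
  then have "?I \<le> 2 * 0 + 2 * 0"
    by (rule tendsto_lowerbound) (intro always_eventually allI le, simp)
  then have "?I = 0" by simp
  then have "AE \<omega> in lborel. ennreal ((cmod (g \<omega> - h \<omega>))\<^sup>2) = 0"
    by (subst (asm) nn_integral_0_iff_AE) auto
  then show ?thesis
    by eventually_elim simp
qed

lemma is_fourier_transform_fourier:
  assumes "is_fourier_transform v g"
  shows "AE \<omega> in lborel. fourier v \<omega> = g \<omega>" "fourier v \<in> borel_measurable lborel"
proof -
  have "is_fourier_transform v (fourier v)"
    unfolding fourier_def using assms by (rule someI[of "is_fourier_transform v"])
  then show "AE \<omega> in lborel. fourier v \<omega> = g \<omega>" "fourier v \<in> borel_measurable lborel"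
    using is_fourier_transform_unique assms by (auto simp: is_fourier_transform_def square_integrable_def)
qed

lemma square_integrable_bound:
  fixes v :: "real ^ 'd \<Rightarrow> complex" and H :: "real ^ 'd \<Rightarrow> real"
  assumes v: "v \<in> borel_measurable lborel" and H: "integrable lborel (\<lambda>x. (H x)\<^sup>2)"
    and le: "\<And>x. cmod (v x) \<le> C * H x"
  shows "square_integrable v"
  unfolding square_integrable_def
proof
  show "integrable lborel (\<lambda>x. (cmod (v x))\<^sup>2)"
  proof (rule Bochner_Integration.integrable_bound)
    show "integrable lborel (\<lambda>x. C\<^sup>2 * (H x)\<^sup>2)"
      using H by simp
    have "(cmod (v x))\<^sup>2 \<le> (C * H x)\<^sup>2" for x
      using le[of x] by (intro power_mono) auto
    then show "AE x in lborel. norm ((cmod (v x))\<^sup>2) \<le> norm (C\<^sup>2 * (H x)\<^sup>2)"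
      by (simp add: power_mult_distrib)
  qed (use v in measurable)
qed (rule v)

text \<open>Pointwise convergence almost everywhere gives convergence in \<open>L\<^sup>2\<close> when all truncated transforms
  lie below one square integrable function.\<close>

lemma is_fourier_transformI_dominated:
  fixes v g :: "real ^ 'd \<Rightarrow> complex" and H :: "real ^ 'd \<Rightarrow> real"
  assumes v: "v \<in> borel_measurable lborel" and g: "g \<in> borel_measurable lborel"
    and H: "integrable lborel (\<lambda>x. (H x)\<^sup>2)"
    and le_v: "\<And>x. cmod (v x) \<le> A * H x" and le_g: "\<And>x. cmod (g x) \<le> B * H x"
    and le_t: "\<And>R \<omega>. 0 \<le> R \<Longrightarrow> cmod (truncated_fourier R v \<omega>) \<le> C * H \<omega>"
    and lim: "AE \<omega> in lborel. ((\<lambda>R. truncated_fourier R v \<omega>) \<longlongrightarrow> g \<omega>) at_top"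
  shows "is_fourier_transform v g"
proof -
  let ?d = "\<lambda>R \<omega>. (cmod (truncated_fourier R v \<omega> - g \<omega>))\<^sup>2"
  note [measurable] = g borel_measurable_truncated_fourier[OF v]
  have int: "integrable lborel (\<lambda>\<omega>. ((C + B) * H \<omega>)\<^sup>2)"
    using H by (simp add: power_mult_distrib)
  have le: "?d R \<omega> \<le> ((C + B) * H \<omega>)\<^sup>2" if "0 \<le> R" for R \<omega>
  proof (rule power_mono)
    show "cmod (truncated_fourier R v \<omega> - g \<omega>) \<le> (C + B) * H \<omega>"
      using norm_triangle_ineq4[of "truncated_fourier R v \<omega>" "g \<omega>"] le_t[OF that, of \<omega>] le_g[of \<omega>]
      by (simp add: distrib_right)
  qed simp
  have "((\<lambda>R. LINT \<omega>|lborel. ?d R \<omega>) \<longlongrightarrow> (LINT \<omega>|(lborel :: (real^'d) measure). 0)) at_top"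
  proof (rule integral_dominated_convergence_at_top[OF _ _ int])
    show "\<forall>\<^sub>F R in at_top. AE \<omega> in lborel. norm (?d R \<omega>) \<le> ((C + B) * H \<omega>)\<^sup>2"
      using eventually_ge_at_top[of 0] by eventually_elim (use le in auto)
    show "AE \<omega> in lborel. ((\<lambda>R. ?d R \<omega>) \<longlongrightarrow> 0) at_top"
      using lim
    proof eventually_elim
      fix \<omega> assume "((\<lambda>R. truncated_fourier R v \<omega>) \<longlongrightarrow> g \<omega>) at_top"
      then have "((\<lambda>R. ?d R \<omega>) \<longlongrightarrow> (cmod (g \<omega> - g \<omega>))\<^sup>2) at_top"
        by (intro tendsto_intros)
      then show "((\<lambda>R. ?d R \<omega>) \<longlongrightarrow> 0) at_top" by simp
    qed
  qed measurable
  then have "((\<lambda>R. ennreal (LINT \<omega>|lborel. ?d R \<omega>)) \<longlongrightarrow> 0) at_top"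
    using tendsto_ennrealI by fastforce
  moreover have "\<forall>\<^sub>F R in at_top. ennreal (LINT \<omega>|lborel. ?d R \<omega>) = (\<integral>\<^sup>+ \<omega>. ennreal (?d R \<omega>) \<partial>lborel)"
    using eventually_ge_at_top[of 0]
  proof eventually_elim
    fix R :: real assume R: "0 \<le> R"
    have "integrable lborel (?d R)"
      by (rule Bochner_Integration.integrable_bound[OF int]) (use le[OF R] in auto)
    then show "ennreal (LINT \<omega>|lborel. ?d R \<omega>) = (\<integral>\<^sup>+ \<omega>. ennreal (?d R \<omega>) \<partial>lborel)"
      by (simp add: nn_integral_eq_integral)
  qed
  ultimately have "((\<lambda>R. \<integral>\<^sup>+ \<omega>. ennreal (?d R \<omega>) \<partial>lborel) \<longlongrightarrow> 0) at_top"
    by (rule Lim_transform_eventually)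
  then show ?thesis
    unfolding is_fourier_transform_def
    using square_integrable_bound[OF v H le_v] square_integrable_bound[OF g H le_g] by blast
qed

section \<open>The Fourier transform of a sinc interpolant\<close>

text \<open>The Fourier transform of the sinc basis function \<open>\<phi>\<^sub>k\<^sup>N\<close>: a phase restricted to the band
  \<open>[-\<pi>N, \<pi>N]\<^sup>d\<close>.\<close>

definition sinc_spectrum :: "nat \<Rightarrow> int ^ 'd \<Rightarrow> real ^ 'd \<Rightarrow> complex" where
  "sinc_spectrum N k \<omega> = complex_of_real (1 / (2 * pi * real N) ^ CARD('d)) *
     of_bool (\<forall>i. \<bar>\<omega> $ i\<bar> \<le> pi * real N) * cis (- (\<omega> \<bullet> grid_point N k))"

lemma cis_sum: "finite A \<Longrightarrow> cis (\<Sum>i\<in>A. f i) = (\<Prod>i\<in>A. cis (f i))"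
  by (induction A rule: finite_induct) (auto simp: cis_mult[symmetric])

lemma sinc_basis_eq:
  assumes "N \<ge> 1"
  shows "sinc_basis N k x = (\<Prod>i\<in>UNIV. sinc (pi * real N * (x $ i - real_of_int (k $ i) / real N)))"
proof -
  have "pi * (real N *\<^sub>R x - real_vec k) $ i = pi * real N * (x $ i - real_of_int (k $ i) / real N)" for i
    using assms by (simp add: real_vec_def field_simps)
  then show ?thesis
    unfolding sinc_basis_def sinc_prod_def by (simp only:)
qed

text \<open>The truncation window is a cube and the wave \<open>e\<^sup>-\<^sup>i\<^sup>\<omega>\<^sup>\<cdot>\<^sup>x\<close> is a product over the coordinates, so the
  integral factors.\<close>

lemma truncated_fourier_sinc_basis:
  fixes k :: "int ^ 'd"
  assumes N: "N \<ge> 1"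
  shows "truncated_fourier R (\<lambda>x. complex_of_real (sinc_basis N k x)) \<omega> =
    complex_of_real (1 / (2 * pi) ^ CARD('d)) *
    (\<Prod>i\<in>UNIV. sinc_fourier_int (pi * real N) (real_of_int (k $ i) / real N) R (\<omega> $ i))"
proof -
  let ?q = "\<lambda>i x. complex_of_real (sinc (pi * real N * (x - real_of_int (k $ i) / real N))) * cis (- (\<omega> $ i * x))"
  have int: "set_integrable lborel {-R..R} (?q i)" for i
    unfolding set_integrable_def
    by (intro borel_integrable_compact continuous_intros compact_Icc)
  have "(LINT x:cbox (\<chi> i. - R) (\<chi> i. R)|lborel. complex_of_real (sinc_basis N k x) * cis (- (\<omega> \<bullet> x))) =
     (LINT x|lborel. (\<Prod>i\<in>UNIV. indicator {-R..R} (x $ i) *\<^sub>R ?q i (x $ i)))"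
    unfolding set_lebesgue_integral_def
  proof (rule Bochner_Integration.integral_cong[OF refl])
    fix x :: "real ^ 'd"
    have 1: "indicator (cbox (\<chi> i. - R) (\<chi> i. R)) x = (\<Prod>i\<in>UNIV. indicator {-R..R} (x $ i) :: real)"
      by (auto simp: mem_box_cart indicator_def)
    have 2: "cis (- (\<omega> \<bullet> x)) = (\<Prod>i\<in>UNIV. cis (- (\<omega> $ i * x $ i)))"
      by (simp add: inner_vec_def sum_negf[symmetric] cis_sum)
    show "indicator (cbox (\<chi> i. - R) (\<chi> i. R)) x *\<^sub>R (complex_of_real (sinc_basis N k x) * cis (- (\<omega> \<bullet> x))) =
       (\<Prod>i\<in>UNIV. indicator {-R..R} (x $ i) *\<^sub>R ?q i (x $ i))"
      unfolding 1 2 sinc_basis_eq[OF N] scaleR_conv_of_real of_real_prod prod.distrib ..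
  qed
  also have "\<dots> = (\<Prod>i\<in>UNIV. (LINT x:{-R..R}|lborel. ?q i x))"
    using integral_lborel_vec_prod[of "\<lambda>i x. indicator {-R..R} x *\<^sub>R ?q i x"] int
    unfolding set_integrable_def set_lebesgue_integral_def by blast
  also have "\<dots> = (\<Prod>i\<in>UNIV. sinc_fourier_int (pi * real N) (real_of_int (k $ i) / real N) R (\<omega> $ i))"
    unfolding sinc_fourier_int_def by (intro prod.cong refl set_borel_integral_eq_integral(2)[OF int])
  finally show ?thesis
    unfolding truncated_fourier_def by (simp only:)
qed

text \<open>In this form the factors are the limits in \<open>sinc_fourier_int_tendsto\<close>.\<close>

lemma sinc_spectrum_prod:
  fixes k :: "int ^ 'd"
  assumes N: "N \<ge> 1"
  shows "sinc_spectrum N k \<omega> = complex_of_real (1 / (2 * pi) ^ CARD('d)) *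
    (\<Prod>i\<in>UNIV. if \<bar>\<omega> $ i\<bar> \<le> pi * real N then complex_of_real (pi / (pi * real N)) *
       cis (- (\<omega> $ i * (real_of_int (k $ i) / real N))) else 0)"
proof (cases "\<forall>i. \<bar>\<omega> $ i\<bar> \<le> pi * real N")
  case True
  have "cis (- (\<omega> \<bullet> grid_point N k)) = (\<Prod>i\<in>UNIV. cis (- (\<omega> $ i * (real_of_int (k $ i) / real N))))"
    by (simp add: inner_vec_def sum_negf[symmetric] cis_sum grid_point_def real_vec_def)
  moreover have "complex_of_real (1 / (2 * pi * real N) ^ CARD('d)) =
      complex_of_real (1 / (2 * pi) ^ CARD('d)) * (\<Prod>i\<in>(UNIV::'d set). complex_of_real (pi / (pi * real N)))"
    by (simp add: power_mult_distrib power_divide)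
  moreover have "of_bool (\<forall>i. \<bar>\<omega> $ i\<bar> \<le> pi * real N) = (1 :: complex)"
    using True by simp
  ultimately show ?thesis
    unfolding sinc_spectrum_def by (simp only: True[rule_format] if_True prod.distrib mult_1_right mult.assoc)
next
  case False
  then obtain i where "\<not> \<bar>\<omega> $ i\<bar> \<le> pi * real N" by blast
  then show ?thesis using False
    by (auto simp: sinc_spectrum_def intro!: exI[of _ i])
qed

lemma sinc_spectrum_measurable [measurable]: "sinc_spectrum N k \<in> borel_measurable borel"
  unfolding sinc_spectrum_def[abs_def] of_bool_def by measurable

lemma continuous_on_sinc_basis: "continuous_on A (sinc_basis N k)"
  unfolding sinc_basis_def[abs_def] sinc_prod_def
  by (intro continuous_on_prod continuous_on_sinc continuous_intros)

lemma sinc_basis_le_vec_weight: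
  fixes k :: "int ^ 'd"
  assumes N: "N \<ge> 1"
  shows "\<exists>A. \<forall>x. \<bar>sinc_basis N k x\<bar> \<le> A * vec_weight x"
proof -
  have a: "0 < pi * real N" using N by simp
  obtain A where A: "\<And>i x. \<bar>sinc (pi * real N * (x - real_of_int (k $ i) / real N))\<bar> \<le> A i * (1 / (1 + \<bar>x\<bar>))"
    using choice[OF allI[OF sinc_le_weight[OF a]], of "\<lambda>i. real_of_int (k $ i) / real N"] by blast
  show ?thesis
  proof (intro exI allI)
    fix x :: "real ^ 'd"
    have "\<bar>sinc_basis N k x\<bar> = (\<Prod>i\<in>UNIV. \<bar>sinc (pi * real N * (x $ i - real_of_int (k $ i) / real N))\<bar>)"
      unfolding sinc_basis_eq[OF N] by (rule abs_prod)
    also have "\<dots> \<le> (\<Prod>i\<in>UNIV. A i) * vec_weight x"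
      by (rule prod_le_vec_weight[OF abs_ge_zero A])
    finally show "\<bar>sinc_basis N k x\<bar> \<le> (\<Prod>i\<in>UNIV. A i) * vec_weight x" .
  qed
qed

lemma sinc_spectrum_le_vec_weight:
  fixes k :: "int ^ 'd"
  assumes N: "N \<ge> 1"
  shows "\<exists>B. \<forall>\<omega>. cmod (sinc_spectrum N k \<omega>) \<le> B * vec_weight \<omega>"
proof (intro exI allI)
  fix \<omega> :: "real ^ 'd"
  define a where "a = pi * real N"
  define b where "b i = real_of_int (k $ i) / real N" for i
  define D where "D = 1 / (2 * pi) ^ CARD('d)"
  have a: "0 < a" using N by (simp add: a_def)
  have D: "0 \<le> D" by (simp add: D_def)
  have B: "cmod (if \<bar>t\<bar> \<le> a then complex_of_real (pi / a) * cis (- (t * b i)) else 0)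
      \<le> (pi / a + pi / a * (a + 1) + 0) * (1 / (1 + \<bar>t\<bar>))" for i t
    by (rule le_weightI) (use a in \<open>auto simp: norm_mult norm_divide\<close>)
  have "cmod (sinc_spectrum N k \<omega>) = D *
     (\<Prod>i\<in>UNIV. cmod (if \<bar>\<omega> $ i\<bar> \<le> a then complex_of_real (pi / a) * cis (- (\<omega> $ i * b i)) else 0))"
    unfolding sinc_spectrum_prod[OF N] a_def b_def D_def norm_mult norm_of_real prod_norm[symmetric] by simp
  also have "\<dots> \<le> D * ((\<Prod>i\<in>(UNIV::'d set). pi / a + pi / a * (a + 1) + 0) * vec_weight \<omega>)"
    by (intro mult_left_mono D prod_le_vec_weight norm_ge_zero B)
  finally show "cmod (sinc_spectrum N k \<omega>) \<le>
      D * (\<Prod>i\<in>(UNIV::'d set). pi / a + pi / a * (a + 1) + 0) * vec_weight \<omega>"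
    by (simp only: mult.assoc)
qed

lemma truncated_fourier_sinc_basis_le_vec_weight:
  fixes k :: "int ^ 'd"
  assumes N: "N \<ge> 1"
  shows "\<exists>C. \<forall>R\<ge>0. \<forall>\<omega>.
    cmod (truncated_fourier R (\<lambda>x. complex_of_real (sinc_basis N k x)) \<omega>) \<le> C * vec_weight \<omega>"
proof -
  define a where "a = pi * real N"
  define b where "b i = real_of_int (k $ i) / real N" for i
  define D where "D = 1 / (2 * pi) ^ CARD('d)"
  have a: "0 < a" using N by (simp add: a_def)
  have D: "0 \<le> D" by (simp add: D_def)
  obtain C where C: "\<And>i R \<omega>. 0 \<le> R \<Longrightarrow> cmod (sinc_fourier_int a (b i) R \<omega>) \<le> C i * (1 / (1 + \<bar>\<omega>\<bar>))"
    using choice[OF allI[OF sinc_fourier_int_le_weight[OF a]], of b] by blast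
  show ?thesis
  proof (intro exI allI impI)
    fix R :: real and \<omega> :: "real ^ 'd" assume R: "0 \<le> R"
    have "cmod (truncated_fourier R (\<lambda>x. complex_of_real (sinc_basis N k x)) \<omega>) = D *
       (\<Prod>i\<in>UNIV. cmod (sinc_fourier_int a (b i) R (\<omega> $ i)))"
      unfolding truncated_fourier_sinc_basis[OF N] a_def b_def D_def norm_mult norm_of_real prod_norm[symmetric] by simp
    also have "\<dots> \<le> D * ((\<Prod>i\<in>UNIV. C i) * vec_weight \<omega>)"
      by (intro mult_left_mono D prod_le_vec_weight norm_ge_zero C R)
    finally show "cmod (truncated_fourier R (\<lambda>x. complex_of_real (sinc_basis N k x)) \<omega>) \<le>
        D * (\<Prod>i\<in>UNIV. C i) * vec_weight \<omega>"
      by (simp only: mult.assoc)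
  qed
qed

lemma truncated_fourier_sinc_basis_tendsto:
  fixes k :: "int ^ 'd"
  assumes N: "N \<ge> 1"
  shows "AE \<omega> in lborel. ((\<lambda>R. truncated_fourier R (\<lambda>x. complex_of_real (sinc_basis N k x)) \<omega>)
     \<longlongrightarrow> sinc_spectrum N k \<omega>) at_top"
  using AE_vec_nth_neq[of "\<lambda>_. pi * real N"] AE_vec_nth_neq[of "\<lambda>_. - (pi * real N)"]
proof eventually_elim
  fix \<omega> :: "real ^ 'd"
  assume "\<forall>i. \<omega> $ i \<noteq> pi * real N" "\<forall>i. \<omega> $ i \<noteq> - (pi * real N)"
  then have "\<bar>\<omega> $ i\<bar> \<noteq> pi * real N" for i
    by (metis abs_if minus_minus)
  then show "((\<lambda>R. truncated_fourier R (\<lambda>x. complex_of_real (sinc_basis N k x)) \<omega>)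
     \<longlongrightarrow> sinc_spectrum N k \<omega>) at_top"
    unfolding truncated_fourier_sinc_basis[OF N] sinc_spectrum_prod[OF N]
    by (intro tendsto_mult tendsto_const tendsto_prod sinc_fourier_int_tendsto) (use N in auto)
qed

lemma truncated_fourier_sum:
  fixes f :: "'k \<Rightarrow> real ^ 'd \<Rightarrow> complex"
  assumes "\<And>k. k \<in> I \<Longrightarrow> continuous_on UNIV (f k)"
  shows "truncated_fourier R (\<lambda>x. \<Sum>k\<in>I. c k * f k x) \<omega> = (\<Sum>k\<in>I. c k * truncated_fourier R (f k) \<omega>)"
proof -
  let ?C = "cbox (\<chi> i. - R) (\<chi> i. R) :: (real ^ 'd) set"
  have int: "set_integrable lborel ?C (\<lambda>x. c k * (f k x * cis (- (\<omega> \<bullet> x))))" if "k \<in> I" for k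
    unfolding set_integrable_def
    using continuous_on_subset[OF assms[OF that]]
    by (intro borel_integrable_compact continuous_intros compact_cbox) auto
  have "(LINT x:?C|lborel. (\<Sum>k\<in>I. c k * f k x) * cis (- (\<omega> \<bullet> x))) =
      (LINT x|lborel. (\<Sum>k\<in>I. indicator ?C x *\<^sub>R (c k * (f k x * cis (- (\<omega> \<bullet> x))))))"
    unfolding set_lebesgue_integral_def
    by (simp add: sum_distrib_right scaleR_sum_right mult.assoc)
  also have "\<dots> = (\<Sum>k\<in>I. (LINT x:?C|lborel. c k * (f k x * cis (- (\<omega> \<bullet> x)))))"
    unfolding set_lebesgue_integral_def
    by (rule Bochner_Integration.integral_sum) (use int in \<open>simp add: set_integrable_def\<close>)
  also have "\<dots> = (\<Sum>k\<in>I. c k * (LINT x:?C|lborel. f k x * cis (- (\<omega> \<bullet> x))))"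
    by simp
  finally show ?thesis
    by (simp add: truncated_fourier_def sum_distrib_left mult_ac)
qed

text \<open>The transform of each basis function is dominated by a multiple of \<open>vec_weight\<close>, and so is the
  finite linear combination. The same weight shows that the interpolant, which decays like the sinc
  function in every coordinate, is square integrable.\<close>

lemma is_fourier_transform_sinc_interp:
  fixes u :: "real ^ 'd \<Rightarrow> complex"
  assumes N: "N \<ge> 1"
  shows "is_fourier_transform (sinc_interp N u) (\<lambda>\<omega>. \<Sum>k\<in>idx N. u (grid_point N k) * sinc_spectrum N k \<omega>)"
proof -
  define c where "c k = u (grid_point N k)" for k
  obtain A where A: "\<And>k x. \<bar>sinc_basis N k x\<bar> \<le> A k * vec_weight (x :: real ^ 'd)"
    using choice[OF allI[OF sinc_basis_le_vec_weight[OF N]], of "\<lambda>k. k"] by blast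
  obtain B where B: "\<And>k \<omega>. cmod (sinc_spectrum N k \<omega>) \<le> B k * vec_weight (\<omega> :: real ^ 'd)"
    using choice[OF allI[OF sinc_spectrum_le_vec_weight[OF N]], of "\<lambda>k. k"] by blast
  obtain C where C: "\<And>k R \<omega>. 0 \<le> R \<Longrightarrow>
      cmod (truncated_fourier R (\<lambda>x. complex_of_real (sinc_basis N k x)) \<omega>) \<le> C k * vec_weight (\<omega> :: real ^ 'd)"
    using choice[OF allI[OF truncated_fourier_sinc_basis_le_vec_weight[OF N]], of "\<lambda>k. k"] by blast
  have sum_le: "cmod (\<Sum>k\<in>idx N. c k * f k) \<le> (\<Sum>k\<in>idx N. cmod (c k) * E k) * w"
    if "\<And>k. cmod (f k) \<le> E k * w" for f E w
    unfolding sum_distrib_right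
  proof (rule order_trans[OF norm_sum sum_mono])
    fix k show "cmod (c k * f k) \<le> cmod (c k) * E k * w"
      using mult_left_mono[OF that[of k] norm_ge_zero[of "c k"]] by (simp add: norm_mult mult.assoc)
  qed
  have cont: "continuous_on UNIV (\<lambda>x. complex_of_real (sinc_basis N k x))" for k :: "int ^ 'd"
    by (intro continuous_intros continuous_on_sinc_basis)
  have trunc: "truncated_fourier R (sinc_interp N u) \<omega> =
      (\<Sum>k\<in>idx N. c k * truncated_fourier R (\<lambda>x. complex_of_real (sinc_basis N k x)) \<omega>)" for R \<omega>
    unfolding sinc_interp_def[abs_def] c_def by (rule truncated_fourier_sum[OF cont])
  show ?thesis
    unfolding c_def[symmetric]
  proof (rule is_fourier_transformI_dominated[OF _ _ integrable_vec_weight_square])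
    have "continuous_on UNIV (sinc_interp N u)"
      unfolding sinc_interp_def[abs_def]
      by (intro continuous_on_sum continuous_on_mult continuous_on_const cont)
    then show "sinc_interp N u \<in> borel_measurable lborel"
      by (simp add: borel_measurable_continuous_onI)
    show "(\<lambda>\<omega>. \<Sum>k\<in>idx N. c k * sinc_spectrum N k \<omega>) \<in> borel_measurable lborel"
      by measurable
    show "cmod (sinc_interp N u x) \<le> (\<Sum>k\<in>idx N. cmod (c k) * A k) * vec_weight x" for x
      unfolding sinc_interp_def c_def[symmetric] by (rule sum_le) (use A in simp)
    show "cmod (\<Sum>k\<in>idx N. c k * sinc_spectrum N k x) \<le> (\<Sum>k\<in>idx N. cmod (c k) * B k) * vec_weight x" for x
      by (rule sum_le[OF B])
    show "cmod (truncated_fourier R (sinc_interp N u) \<omega>) \<le> (\<Sum>k\<in>idx N. cmod (c k) * C k) * vec_weight \<omega>"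
      if "0 \<le> R" for R \<omega>
      unfolding trunc by (rule sum_le[OF C[OF that]])
    have "AE \<omega> in lborel. \<forall>k::int^'d. ((\<lambda>R. truncated_fourier R (\<lambda>x. complex_of_real (sinc_basis N k x)) \<omega>)
     \<longlongrightarrow> sinc_spectrum N k \<omega>) at_top"
      unfolding AE_all_countable using truncated_fourier_sinc_basis_tendsto[OF N] by blast
    then show "AE \<omega> in lborel. ((\<lambda>R. truncated_fourier R (sinc_interp N u) \<omega>) \<longlongrightarrow>
        (\<Sum>k\<in>idx N. c k * sinc_spectrum N k \<omega>)) at_top"
      unfolding trunc by eventually_elim (intro tendsto_intros, auto)
  qed
qed

section \<open>Riemann sums over a cubic grid\<close>

lemma finite_vec_box: "finite {k :: int ^ 'd. \<forall>i. a \<le> k $ i \<and> k $ i \<le> b}"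
proof (rule finite_subset)
  show "finite (vec_lambda ` (UNIV \<rightarrow>\<^sub>E {a..b}) :: (int ^ 'd) set)"
    by (intro finite_imageI finite_PiE) auto
  show "{k :: int ^ 'd. \<forall>i. a \<le> k $ i \<and> k $ i \<le> b} \<subseteq> vec_lambda ` (UNIV \<rightarrow>\<^sub>E {a..b})"
  proof
    fix k :: "int ^ 'd" assume "k \<in> {k. \<forall>i. a \<le> k $ i \<and> k $ i \<le> b}"
    then have "k = vec_lambda (($) k)" "($) k \<in> UNIV \<rightarrow>\<^sub>E {a..b}" by auto
    then show "k \<in> vec_lambda ` (UNIV \<rightarrow>\<^sub>E {a..b})" by blast
  qed
qed

lemma finite_idx: "finite (idx M)" and finite_idx_sym: "finite (idx_sym M)"
  unfolding idx_def idx_sym_def by (rule finite_vec_box)+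

text \<open>Half-open cells make the tiling exact: every point lies in exactly one cell.\<close>

definition grid_cell :: "real \<Rightarrow> int ^ 'd \<Rightarrow> (real ^ 'd) set" where
  "grid_cell h j = {\<omega>. \<forall>i. h * real_of_int (j $ i) \<le> \<omega> $ i \<and> \<omega> $ i < h * (real_of_int (j $ i) + 1)}"

lemma grid_cell_iff:
  assumes "0 < h"
  shows "\<omega> \<in> grid_cell h j \<longleftrightarrow> j = (\<chi> i. \<lfloor>\<omega> $ i / h\<rfloor>)"
  using assms
  by (auto simp: grid_cell_def vec_eq_iff floor_eq_iff eq_commute[of _ "\<lfloor>_\<rfloor>"] pos_le_divide_eq pos_divide_less_eq mult.commute)

lemma grid_cell_measurable [measurable]: "grid_cell h j \<in> sets borel"
proof -
  have "grid_cell h j = (\<Inter>i. {\<omega>. h * real_of_int (j $ i) \<le> \<omega> $ i \<and> \<omega> $ i < h * (real_of_int (j $ i) + 1)})"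
    by (auto simp: grid_cell_def)
  also have "\<dots> \<in> sets borel" by measurable
  finally show ?thesis .
qed

lemma emeasure_grid_cell:
  fixes j :: "int ^ 'd"
  assumes h: "0 < h"
  shows "emeasure lborel (grid_cell h j) = ennreal (h ^ CARD('d))"
proof (rule antisym)
  define l u :: "real ^ 'd" where "l = (\<chi> i. h * real_of_int (j $ i))" and "u = (\<chi> i. h * (real_of_int (j $ i) + 1))"
  have "(u - l) \<bullet> b = h" if "b \<in> Basis" for b
    using that by (auto simp: Basis_vec_def inner_axis u_def l_def algebra_simps)
  then have vol: "(\<Prod>b\<in>Basis. (u - l) \<bullet> b) = h ^ CARD('d)"
    by simp
  have le: "l \<bullet> b \<le> u \<bullet> b" if "b \<in> Basis" for b
    using that h by (auto simp: Basis_vec_def inner_axis u_def l_def algebra_simps)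
  have "emeasure lborel (grid_cell h j) \<le> emeasure lborel (cbox l u)"
    by (intro emeasure_mono) (auto simp: grid_cell_def mem_box_cart l_def u_def less_imp_le)
  then show "emeasure lborel (grid_cell h j) \<le> ennreal (h ^ CARD('d))"
    using le by (simp add: vol)
  have "emeasure lborel (box l u) \<le> emeasure lborel (grid_cell h j)"
    by (intro emeasure_mono) (auto simp: grid_cell_def mem_box_cart l_def u_def less_imp_le)
  then show "ennreal (h ^ CARD('d)) \<le> emeasure lborel (grid_cell h j)"
    using le by (simp add: vol)
qed

text \<open>The lower corner of the cell that contains \<open>\<omega>\<close>.\<close>

definition grid_round :: "real \<Rightarrow> real ^ 'd \<Rightarrow> real ^ 'd" where
  "grid_round h \<omega> = h *\<^sub>R real_vec (\<chi> i. \<lfloor>\<omega> $ i / h\<rfloor>)"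

lemma grid_round_nth: "grid_round h \<omega> $ i = h * real_of_int \<lfloor>\<omega> $ i / h\<rfloor>"
  by (simp add: grid_round_def real_vec_def)

lemma grid_round_tendsto: "((\<lambda>h. grid_round h \<omega>) \<longlongrightarrow> \<omega>) (at_right 0)"
proof (rule vec_tendstoI)
  fix i
  show "((\<lambda>h. grid_round h \<omega> $ i) \<longlongrightarrow> \<omega> $ i) (at_right 0)"
  proof (rule tendsto_sandwich)
    show "\<forall>\<^sub>F h in at_right 0. \<omega> $ i - h \<le> grid_round h \<omega> $ i"
      using eventually_at_right_less
    proof eventually_elim
      fix h :: real assume h: "0 < h"
      have "\<omega> $ i / h \<le> real_of_int \<lfloor>\<omega> $ i / h\<rfloor> + 1" by linarith
      from mult_left_mono[OF this less_imp_le[OF h]] h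
      show "\<omega> $ i - h \<le> grid_round h \<omega> $ i" by (simp add: grid_round_nth algebra_simps)
    qed
    show "\<forall>\<^sub>F h in at_right 0. grid_round h \<omega> $ i \<le> \<omega> $ i"
      using eventually_at_right_less
    proof eventually_elim
      fix h :: real assume h: "0 < h"
      have "real_of_int \<lfloor>\<omega> $ i / h\<rfloor> \<le> \<omega> $ i / h" by linarith
      from mult_left_mono[OF this less_imp_le[OF h]] h
      show "grid_round h \<omega> $ i \<le> \<omega> $ i" by (simp add: grid_round_nth)
    qed
    have "((\<lambda>h. \<omega> $ i - h) \<longlongrightarrow> \<omega> $ i - 0) (at_right 0)"
      by (intro tendsto_intros)
    then show "((\<lambda>h. \<omega> $ i - h) \<longlongrightarrow> \<omega> $ i) (at_right 0)" by simp
  qed simp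
qed

definition half_open_cube :: "real \<Rightarrow> (real ^ 'd) set" where
  "half_open_cube a = {\<omega>. \<forall>i. - a \<le> \<omega> $ i \<and> \<omega> $ i < a}"

lemma half_open_cube_measurable [measurable]: "half_open_cube a \<in> sets borel"
proof -
  have "half_open_cube a = (\<Inter>i. {\<omega>. - a \<le> \<omega> $ i \<and> \<omega> $ i < a})"
    by (auto simp: half_open_cube_def)
  also have "\<dots> \<in> sets borel" by measurable
  finally show ?thesis .
qed

lemma half_open_cube_subset: "half_open_cube a \<subseteq> cbox (\<chi> i. - a) (\<chi> i. a)"
  by (auto simp: half_open_cube_def mem_box_cart less_imp_le)

lemma grid_round_measurable [measurable]: "grid_round h \<in> borel_measurable borel"
  by (rule borel_measurable_euclidean_space[THEN iffD2])
     (auto simp: Basis_vec_def inner_axis grid_round_nth)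

text \<open>Since \<open>M\<close> is even, the cube \<open>[-hM/2, hM/2)\<^sup>d\<close> is a union of whole cells, and the symmetric index
  set lists them. This is where evenness of \<open>SN\<close> enters.\<close>

lemma idx_sym_iff_half_open_cube:
  fixes \<omega> :: "real ^ 'd"
  assumes h: "0 < h" and M: "even M" and a: "a = h * real M / 2"
  shows "(\<chi> i. \<lfloor>\<omega> $ i / h\<rfloor>) \<in> idx_sym M \<longleftrightarrow> \<omega> \<in> half_open_cube a"
proof -
  obtain m where m: "M = 2 * m" using M by blast
  have "- int m \<le> \<lfloor>t / h\<rfloor> \<and> \<lfloor>t / h\<rfloor> \<le> int m - 1 \<longleftrightarrow> - a \<le> t \<and> t < a" for t :: real
  proof -
    have "- int m \<le> \<lfloor>t / h\<rfloor> \<longleftrightarrow> - a \<le> t"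
      using h by (simp add: le_floor_iff a m pos_le_divide_eq mult.commute)
    moreover have "\<lfloor>t / h\<rfloor> \<le> int m - 1 \<longleftrightarrow> t < a"
    proof -
      have "\<lfloor>t / h\<rfloor> \<le> int m - 1 \<longleftrightarrow> \<lfloor>t / h\<rfloor> < int m" by linarith
      also have "\<dots> \<longleftrightarrow> t < a"
        using h by (simp add: floor_less_iff a m pos_divide_less_eq mult.commute)
      finally show ?thesis .
    qed
    ultimately show ?thesis by blast
  qed
  then show ?thesis
    by (simp add: idx_sym_def half_open_cube_def m)
qed

text \<open>The Riemann sum is the exact integral of a step function, namely of \<open>F\<close> evaluated at the lower
  corner of the current cell. Its convergence can then be read off from dominated convergence.\<close>

lemma riemann_sum_eq_integral:
  fixes F :: "real ^ 'd \<Rightarrow> complex"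
  assumes h: "0 < h" and M: "even M" and a: "a = h * real M / 2"
  shows "complex_of_real (h ^ CARD('d)) * (\<Sum>j\<in>idx_sym M. F (h *\<^sub>R real_vec j)) =
    (LINT \<omega>|lborel. indicator (half_open_cube a) \<omega> *\<^sub>R F (grid_round h \<omega>))"
proof -
  have cell: "measure lborel (grid_cell h j) = h ^ CARD('d)" for j :: "int ^ 'd"
    using emeasure_grid_cell[OF h, of j] h by (simp add: measure_def)
  have fm: "emeasure lborel (grid_cell h j) < \<infinity>" for j :: "int ^ 'd"
    using emeasure_grid_cell[OF h, of j] by simp
  have "(LINT \<omega>|lborel. indicator (half_open_cube a) \<omega> *\<^sub>R F (grid_round h \<omega>)) =
     (LINT \<omega>|lborel. (\<Sum>j\<in>idx_sym M. indicator (grid_cell h j) \<omega> *\<^sub>R F (h *\<^sub>R real_vec j)))"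
  proof (rule Bochner_Integration.integral_cong[OF refl])
    fix \<omega> :: "real ^ 'd"
    define j where "j = (\<chi> i. \<lfloor>\<omega> $ i / h\<rfloor>)"
    have "(\<Sum>j\<in>idx_sym M. indicator (grid_cell h j) \<omega> *\<^sub>R F (h *\<^sub>R real_vec j)) =
       (\<Sum>j'\<in>idx_sym M. if j = j' then F (h *\<^sub>R real_vec j) else 0)"
      by (intro sum.cong refl) (auto simp: indicator_def grid_cell_iff[OF h] j_def)
    also have "\<dots> = (if j \<in> idx_sym M then F (h *\<^sub>R real_vec j) else 0)"
      by (rule sum.delta'[OF finite_idx_sym])
    also have "\<dots> = indicator (half_open_cube a) \<omega> *\<^sub>R F (grid_round h \<omega>)"
      using idx_sym_iff_half_open_cube[OF h M a, of \<omega>] by (simp add: j_def grid_round_def indicator_def)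
    finally show "indicator (half_open_cube a) \<omega> *\<^sub>R F (grid_round h \<omega>) =
      (\<Sum>j\<in>idx_sym M. indicator (grid_cell h j) \<omega> *\<^sub>R F (h *\<^sub>R real_vec j))" ..
  qed
  also have "\<dots> = (\<Sum>j\<in>idx_sym M. (LINT \<omega>|lborel. indicator (grid_cell h j) \<omega> *\<^sub>R F (h *\<^sub>R real_vec j)))"
    by (intro Bochner_Integration.integral_sum integrable_scaleR_left integrable_real_indicator)
       (use fm in auto)
  also have "\<dots> = (\<Sum>j\<in>idx_sym M. (h ^ CARD('d)) *\<^sub>R F (h *\<^sub>R real_vec j))"
    using fm by (simp add: cell)
  finally show ?thesis
    by (simp add: sum_distrib_left scaleR_conv_of_real)
qed

lemma riemann_integral_tendsto:
  fixes F :: "real ^ 'd \<Rightarrow> complex"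
  assumes F: "continuous_on UNIV F"
  shows "((\<lambda>h. LINT \<omega>|lborel. indicator (half_open_cube a) \<omega> *\<^sub>R F (grid_round h \<omega>)) \<longlongrightarrow>
     (LINT \<omega>|lborel. indicator (half_open_cube a) \<omega> *\<^sub>R F \<omega>)) (at_right 0)"
proof -
  \<comment> \<open>Rounding moves a coordinate down by at most the mesh, which is below \<open>1\<close> here, so \<open>F\<close> is only evaluated in \<open>?K\<close>.\<close>
  let ?K = "cbox (\<chi> i. - a - 1) (\<chi> i. a) :: (real ^ 'd) set"
  have [measurable]: "F \<in> borel_measurable borel"
    using F by (rule borel_measurable_continuous_onI)
  have "compact (F ` ?K)"
    by (intro compact_continuous_image continuous_on_subset[OF F]) auto
  then obtain B where B: "\<And>x. x \<in> ?K \<Longrightarrow> cmod (F x) \<le> B"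
    by (meson compact_imp_bounded bounded_iff imageI)
  have finD: "emeasure lborel (half_open_cube a :: (real ^ 'd) set) < \<infinity>"
    by (rule order_le_less_trans[OF emeasure_mono[OF half_open_cube_subset] emeasure_lborel_cbox_finite]) simp
  show ?thesis
  proof (rule tendsto_at_right_sequentially[of 0 1])
    fix S :: "nat \<Rightarrow> real"
    assume S: "\<And>n. 0 < S n" "\<And>n. S n < 1" "S \<longlonglongrightarrow> 0"
    have S0: "filterlim S (at_right 0) sequentially"
      using S by (intro filterlim_at_withinI) auto
    show "(\<lambda>n. LINT \<omega>|lborel. indicator (half_open_cube a) \<omega> *\<^sub>R F (grid_round (S n) \<omega>)) \<longlonglongrightarrow>
       (LINT \<omega>|lborel. indicator (half_open_cube a) \<omega> *\<^sub>R F \<omega>)"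
    proof (rule integral_dominated_convergence[where w = "\<lambda>\<omega>. indicator (half_open_cube a) \<omega> * B"])
      show "integrable lborel (\<lambda>\<omega>::real^'d. indicator (half_open_cube a) \<omega> * B)"
        using finD by (intro integrable_mult_left integrable_real_indicator) auto
      have "(\<lambda>n. F (grid_round (S n) \<omega>)) \<longlonglongrightarrow> F \<omega>" for \<omega>
      proof (rule isCont_tendsto_compose[OF _ filterlim_compose[OF grid_round_tendsto S0]])
        show "isCont F \<omega>"
          using F by (simp add: continuous_on_eq_continuous_at)
      qed
      then show "AE \<omega> in lborel. (\<lambda>n. indicator (half_open_cube a) \<omega> *\<^sub>R F (grid_round (S n) \<omega>)) \<longlonglongrightarrow>
          indicator (half_open_cube a) \<omega> *\<^sub>R F \<omega>"
        by (intro AE_I2 tendsto_intros)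
      fix n
      have "cmod (F (grid_round (S n) \<omega>)) \<le> B" if "\<omega> \<in> half_open_cube a" for \<omega>
      proof (rule B, unfold mem_box_cart, intro allI)
        fix i
        have "real_of_int \<lfloor>\<omega> $ i / S n\<rfloor> \<le> \<omega> $ i / S n" "\<omega> $ i / S n \<le> real_of_int \<lfloor>\<omega> $ i / S n\<rfloor> + 1"
          by linarith+
        from this[THEN mult_left_mono, OF less_imp_le[OF S(1)[of n]]] S(1)[of n]
        have "grid_round (S n) \<omega> $ i \<le> \<omega> $ i" "\<omega> $ i - S n \<le> grid_round (S n) \<omega> $ i"
          by (auto simp: grid_round_nth algebra_simps)
        moreover have "- a \<le> \<omega> $ i" "\<omega> $ i < a"
          using that by (auto simp: half_open_cube_def)
        ultimately show "(\<chi> i. - a - 1) $ i \<le> grid_round (S n) \<omega> $ i \<and> grid_round (S n) \<omega> $ i \<le> (\<chi> i. a) $ i"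
          using S(2)[of n] by simp
      qed
      then show "AE \<omega> in lborel. norm (indicator (half_open_cube a) \<omega> *\<^sub>R F (grid_round (S n) \<omega>)) \<le>
          indicator (half_open_cube a) \<omega> * B"
        by (auto simp: indicator_def)
    qed measurable
  qed simp
qed

section \<open>Both fractional Laplacians as averages of one symbol\<close>

text \<open>The chosen Fourier transform is known only up to a null set, which the integral does not see.\<close>

lemma sinc_frac_laplacian_eq:
  fixes u :: "real ^ 'd \<Rightarrow> complex"
  assumes N: "N \<ge> 1"
  shows "sinc_frac_laplacian s N u x =
    (LINT \<omega>|lborel. complex_of_real (norm \<omega> powr (2 * s)) *
       (\<Sum>k\<in>idx N. u (grid_point N k) * sinc_spectrum N k \<omega>) * cis (\<omega> \<bullet> x))"
  unfolding sinc_frac_laplacian_def frac_laplacian_def inv_fourier_def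
proof (rule integral_cong_AE)
  note F = is_fourier_transform_fourier[OF is_fourier_transform_sinc_interp[OF N, of u]]
  note [measurable] = F(2)
  show "(\<lambda>\<omega>. complex_of_real (norm \<omega> powr (2 * s)) * fourier (sinc_interp N u) \<omega> * cis (\<omega> \<bullet> x))
      \<in> borel_measurable lborel"
    by measurable
  show "(\<lambda>\<omega>. complex_of_real (norm \<omega> powr (2 * s)) *
       (\<Sum>k\<in>idx N. u (grid_point N k) * sinc_spectrum N k \<omega>) * cis (\<omega> \<bullet> x)) \<in> borel_measurable lborel"
    by measurable
  show "AE \<omega> in lborel. complex_of_real (norm \<omega> powr (2 * s)) * fourier (sinc_interp N u) \<omega> * cis (\<omega> \<bullet> x) =
    complex_of_real (norm \<omega> powr (2 * s)) *
       (\<Sum>k\<in>idx N. u (grid_point N k) * sinc_spectrum N k \<omega>) * cis (\<omega> \<bullet> x)"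
    using F(1) by eventually_elim simp
qed

lemma continuous_on_norm_powr:
  assumes "0 < p"
  shows "continuous_on A (\<lambda>\<omega>::real^'d. norm \<omega> powr p)"
  using assms by (intro continuous_on_powr' continuous_intros) auto

text \<open>The function whose integral over the band, and whose Riemann sums, are the two operators at the
  point \<open>x\<close>.\<close>

definition freq_symbol :: "real \<Rightarrow> nat \<Rightarrow> (real ^ 'd \<Rightarrow> complex) \<Rightarrow> real ^ 'd \<Rightarrow> real ^ 'd \<Rightarrow> complex" where
  "freq_symbol s N u x \<omega> = complex_of_real (norm \<omega> powr (2 * s)) *
     (\<Sum>k\<in>idx N. u (grid_point N k) * cis (- (\<omega> \<bullet> grid_point N k))) * cis (\<omega> \<bullet> x)"

text \<open>The closed band may be replaced by the half-open cube that the grid cells tile, since the two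
  differ by a null set.\<close>

lemma sinc_frac_laplacian_eq_cube_integral:
  fixes u :: "real ^ 'd \<Rightarrow> complex"
  assumes N: "N \<ge> 1"
  shows "sinc_frac_laplacian s N u x = complex_of_real (1 / (2 * pi * real N) ^ CARD('d)) *
    (LINT \<omega>|lborel. indicator (half_open_cube (pi * real N)) \<omega> *\<^sub>R freq_symbol s N u x \<omega>)"
proof -
  let ?c = "complex_of_real (1 / (2 * pi * real N) ^ CARD('d))"
  have [measurable]: "(\<lambda>\<omega>. indicator (half_open_cube (pi * real N)) \<omega> *\<^sub>R freq_symbol s N u x \<omega>) \<in> borel_measurable lborel"
    unfolding freq_symbol_def by measurable
  have "sinc_frac_laplacian s N u x =
    (LINT \<omega>|lborel. ?c * (indicator (half_open_cube (pi * real N)) \<omega> *\<^sub>R freq_symbol s N u x \<omega>))"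
    unfolding sinc_frac_laplacian_eq[OF N]
  proof (rule integral_cong_AE)
    show "(\<lambda>\<omega>. complex_of_real (norm \<omega> powr (2 * s)) *
       (\<Sum>k\<in>idx N. u (grid_point N k) * sinc_spectrum N k \<omega>) * cis (\<omega> \<bullet> x)) \<in> borel_measurable lborel"
      by measurable
    show "AE \<omega> in lborel. complex_of_real (norm \<omega> powr (2 * s)) *
       (\<Sum>k\<in>idx N. u (grid_point N k) * sinc_spectrum N k \<omega>) * cis (\<omega> \<bullet> x) =
       ?c * (indicator (half_open_cube (pi * real N)) \<omega> *\<^sub>R freq_symbol s N u x \<omega>)"
      using AE_vec_nth_neq[of "\<lambda>_. pi * real N"]
    proof eventually_elim
      fix \<omega> :: "real ^ 'd" assume "\<forall>i. \<omega> $ i \<noteq> pi * real N"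
      then have "(\<forall>i. \<bar>\<omega> $ i\<bar> \<le> pi * real N) \<longleftrightarrow> \<omega> \<in> half_open_cube (pi * real N)"
        by (auto simp: half_open_cube_def abs_le_iff less_le minus_le_iff)
      then have "sinc_spectrum N k \<omega> = ?c * indicator (half_open_cube (pi * real N)) \<omega> * cis (- (\<omega> \<bullet> grid_point N k))" for k
        by (simp add: sinc_spectrum_def indicator_def of_bool_def)
      then have "(\<Sum>k\<in>idx N. u (grid_point N k) * sinc_spectrum N k \<omega>) =
        ?c * indicator (half_open_cube (pi * real N)) \<omega> * (\<Sum>k\<in>idx N. u (grid_point N k) * cis (- (\<omega> \<bullet> grid_point N k)))"
        by (simp only: sum_distrib_left mult_ac)
      then show "complex_of_real (norm \<omega> powr (2 * s)) *
       (\<Sum>k\<in>idx N. u (grid_point N k) * sinc_spectrum N k \<omega>) * cis (\<omega> \<bullet> x) =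
       ?c * (indicator (half_open_cube (pi * real N)) \<omega> *\<^sub>R freq_symbol s N u x \<omega>)"
        by (simp only: freq_symbol_def scaleR_conv_of_real of_real_indicator mult_ac)
    qed
  qed measurable
  then show ?thesis by (simp only: integral_mult_right_zero)
qed

text \<open>With \<open>\<omega> = hj\<close> and \<open>h = 2\<pi>/S\<close>, one has \<open>|2\<pi>j| = S|\<omega>|\<close>, which absorbs the factor \<open>S\<^sup>-\<^sup>2\<^sup>s\<close>, the phases
  \<open>2\<pi> j\<cdot>k/(SN)\<close> become \<open>\<omega>\<cdot>k/N\<close>, and \<open>(SN)\<^sup>-\<^sup>d = (2\<pi>N)\<^sup>-\<^sup>d h\<^sup>d\<close> supplies the volume of a cell. The extension
  by zero reduces the discrete Fourier transform to the indices in \<open>{0, ..., N-1}\<^sup>d\<close>.\<close>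

lemma periodic_frac_laplacian_eq_riemann_sum:
  fixes u :: "real ^ 'd \<Rightarrow> complex"
  assumes N: "N \<ge> 1" and S: "S \<ge> 1"
  defines "h \<equiv> 2 * pi / real S"
  shows "complex_of_real (real S powr (- 2 * s)) * periodic_frac_laplacian s S N u \<kappa> =
    complex_of_real (1 / (2 * pi * real N) ^ CARD('d)) *
    (complex_of_real (h ^ CARD('d)) * (\<Sum>j\<in>idx_sym (S * N). freq_symbol s N u (grid_point N \<kappa>) (h *\<^sub>R real_vec j)))"
proof -
  have phase: "2 * pi * (real_vec j \<bullet> real_vec k) / real (S * N) = (h *\<^sub>R real_vec j) \<bullet> grid_point N k" for j k :: "int ^ 'd"
    by (simp add: h_def grid_point_def)
  have sub: "idx N \<subseteq> (idx (S * N) :: (int ^ 'd) set)"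
  proof -
    have "int N \<le> int (S * N)" using S by (simp del: of_nat_mult)
    then show ?thesis
      unfolding idx_def by (blast intro: order_trans diff_right_mono)
  qed
  have dft: "dft (S * N) (zero_ext N u) j =
      (\<Sum>k\<in>idx N. u (grid_point N k) * cis (- ((h *\<^sub>R real_vec j) \<bullet> grid_point N k)))" for j :: "int ^ 'd"
  proof -
    have "dft (S * N) (zero_ext N u) j =
       (\<Sum>k\<in>idx (S * N). if k \<in> idx N then u (grid_point N k) * cis (- ((h *\<^sub>R real_vec j) \<bullet> grid_point N k)) else 0)"
      unfolding dft_def zero_ext_def phase[symmetric]
      by (intro sum.cong refl) auto
    also have "\<dots> = (\<Sum>k\<in>idx N. u (grid_point N k) * cis (- ((h *\<^sub>R real_vec j) \<bullet> grid_point N k)))"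
      using sub by (subst sum.inter_restrict[OF finite_idx, symmetric]) (simp only: Int_absorb1)
    finally show ?thesis .
  qed
  have scale: "real S powr (- 2 * s) * norm ((2 * pi) *\<^sub>R real_vec j) powr (2 * s) = norm (h *\<^sub>R real_vec j) powr (2 * s)"
    for j :: "int ^ 'd"
  proof -
    have "norm ((2 * pi) *\<^sub>R real_vec j) = real S * norm (h *\<^sub>R real_vec j)"
      using S by (simp add: h_def)
    moreover have "real S powr (- 2 * s) * (real S * n) powr (2 * s) = n powr (2 * s)" if "0 \<le> n" for n
      using that S by (simp add: powr_mult powr_minus)
    ultimately show ?thesis by (simp only: norm_ge_zero)
  qed
  have const: "1 / real (S * N) ^ CARD('d) = 1 / (2 * pi * real N) ^ CARD('d) * h ^ CARD('d)"
    using S N by (simp add: h_def power_divide power_mult_distrib)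
  have "complex_of_real (real S powr (- 2 * s)) * periodic_frac_laplacian s S N u \<kappa> =
     complex_of_real (1 / real (S * N) ^ CARD('d)) *
     (\<Sum>j\<in>idx_sym (S * N). complex_of_real (real S powr (- 2 * s) * norm ((2 * pi) *\<^sub>R real_vec j) powr (2 * s)) *
       dft (S * N) (zero_ext N u) j * cis ((h *\<^sub>R real_vec j) \<bullet> grid_point N \<kappa>))"
    unfolding periodic_frac_laplacian_def phase by (simp only: sum_distrib_left mult_ac of_real_mult)
  then show ?thesis
    unfolding scale dft const freq_symbol_def[symmetric] by simp
qed

theorem theorem3p1:
  fixes u :: "real ^ 'd \<Rightarrow> complex" and N :: nat and s :: real
  assumes "N \<ge> 1" and "0 < s" and "s < 1"
    and "u \<in> Cc (cbox 0 1)"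
  shows "\<forall>\<kappa> \<in> idx N.
    ((\<lambda>S. complex_of_real (real S powr (- 2 * s)) * periodic_frac_laplacian s S N u \<kappa>)
       \<longlongrightarrow> sinc_frac_laplacian s N u (grid_point N \<kappa>))
      (inf sequentially (principal {S. even (S * N)}))"
proof
  fix \<kappa> :: "int ^ 'd"
  let ?F = "freq_symbol s N u (grid_point N \<kappa>)"
  let ?c = "complex_of_real (1 / (2 * pi * real N) ^ CARD('d))"
  let ?I = "\<lambda>h. LINT \<omega>|lborel. indicator (half_open_cube (pi * real N)) \<omega> *\<^sub>R ?F (grid_round h \<omega>)"
  have cont: "continuous_on UNIV ?F"
    unfolding freq_symbol_def using assms(2)
    by (intro continuous_intros continuous_on_norm_powr) auto
  have "filterlim (\<lambda>S. 2 * pi / real S) (at_right 0) sequentially"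
    by (intro filterlim_at_withinI eventually_mono[OF eventually_gt_at_top[of 0]]
          real_tendsto_divide_at_top[OF tendsto_const filterlim_real_sequentially]) auto
  from tendsto_mult[OF tendsto_const[of ?c] filterlim_compose[OF riemann_integral_tendsto[OF cont] this]]
  have "(\<lambda>S. ?c * ?I (2 * pi / real S)) \<longlonglongrightarrow> sinc_frac_laplacian s N u (grid_point N \<kappa>)"
    unfolding sinc_frac_laplacian_eq_cube_integral[OF assms(1)] .
  then have lim: "((\<lambda>S. ?c * ?I (2 * pi / real S)) \<longlongrightarrow> sinc_frac_laplacian s N u (grid_point N \<kappa>))
      (inf sequentially (principal {S. even (S * N)}))"
    by (rule tendsto_mono[OF inf_le1])
  have "\<forall>\<^sub>F S in inf sequentially (principal {S. even (S * N)}). ?c * ?I (2 * pi / real S) =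
      complex_of_real (real S powr (- 2 * s)) * periodic_frac_laplacian s S N u \<kappa>"
    unfolding eventually_inf_principal
    using eventually_ge_at_top[of 1]
  proof eventually_elim
    fix S :: nat assume S: "1 \<le> S"
    show "S \<in> {S. even (S * N)} \<longrightarrow> ?c * ?I (2 * pi / real S) =
      complex_of_real (real S powr (- 2 * s)) * periodic_frac_laplacian s S N u \<kappa>"
    proof
      assume "S \<in> {S. even (S * N)}"
      then have ev: "even (S * N)" by simp
      have h: "0 < 2 * pi / real S" and a: "pi * real N = 2 * pi / real S * real (S * N) / 2"
        using S by simp_all
      show "?c * ?I (2 * pi / real S) =
        complex_of_real (real S powr (- 2 * s)) * periodic_frac_laplacian s S N u \<kappa>"
        unfolding periodic_frac_laplacian_eq_riemann_sum[OF assms(1) S]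
          riemann_sum_eq_integral[OF h ev a] ..
    qed
  qed
  then show "((\<lambda>S. complex_of_real (real S powr (- 2 * s)) * periodic_frac_laplacian s S N u \<kappa>)
       \<longlongrightarrow> sinc_frac_laplacian s N u (grid_point N \<kappa>))
      (inf sequentially (principal {S. even (S * N)}))"
    by (rule Lim_transform_eventually[OF lim])
qed

end
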